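(* Let $W:\mathbb{R}\to\mathbb{R}$ be a fixed smooth nonnegative function with compact support in $[0,1]$, and write $\hat W(0)=\int_{\mathbb{R}}W(t)\,dt$. Let $N\geq 1$, let $\alpha_m$ ($m\in\mathbb{N}$) be complex numbers with $|\alpha_m|\leq 1$, and for a lattice $\lambda\subseteq\mathbb{Z}^2$ put $$\psi(\lambda,N,\alpha)=\sum_{\substack{(m,n)\in\lambda\\ 0<m\leq N,\ n\in\mathbb{Z}}}\alpha_m W\!\left(\frac{n}{N}\right).$$ Let $D,M_1\geq 1$ and let $\Lambda$ be a set of full-rank lattices in $\mathbb{Z}^2$ such that for each $\lambda\in\Lambda$: $D\leq\det\lambda<2D$; the greatest common divisor of the set $\{m:(m,n)\in\lambda\}$ of first coordinates of points of $\lambda$ is $1$; and, for the chosen reduced basis matrix $B=B(\lambda)$ of $\lambda$ (described in the context), $M_1\leq B_{11}<2M_1$. Suppose further that for each integer $m$ with $M_1\leq m<2M_1$ there is at most one $\lambda\in\Lambda$ with $B_{11}(\lambda)=m$. Let $\delta>0$. \begin{enumerate} \item If $D\leq N^{1-\delta}$ then for any $A>0$, $$\sum_{\lambda\in\Lambda}\left|\psi(\lambda,N,\alpha)-\frac{N\hat W(0)}{\det\lambda}\sum_{m\leq N}\alpha_m\right|\ll_{\delta,A}N^{-A}.$$ \item If $N^{1-\delta}\leq D<M_1N^{1-\delta}$ then for any $\epsilon>0$, $$\sum_{\lambda\in\Lambda}\left|\psi(\lambda,N,\alpha)-\frac{N\hat W(0)}{\det\lambda}\sum_{m\leq N}\alpha_m\right|\ll_{\epsilon,\delta}N^{1+2\delta+\epsilon}M_1^{-1/2}D^{1/2}.$$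 \end{enumerate} Implied constants may also depend on $W$.
   Context: For a lattice $\lambda\subseteq\mathbb{Z}^2$, a reduced basis is chosen as follows: $B_1$ is a nonzero element of $\lambda$ of minimal Euclidean length, and $B_2$ is an element of minimal Euclidean length among the elements of $\lambda$ that are not multiples of $B_1$ (when minimal vectors are not unique, any such choice may be made). Then $\{B_1,B_2\}$ is a basis of $\lambda$. Signs of $B_1,B_2$ are chosen so that $B_{11}\geq 0$ and $\det B=\det\lambda$, where $B$ is the $2\times 2$ matrix with rows $B_1=(B_{11},B_{12})$ and $B_2=(B_{21},B_{22})$. The notation $\ll_{a}$ means the inequality holds up to a constant depending only on the indicated parameters (and $W$). *)

theory Defs
  imports "HOL-Analysis.Analysis"
begin

definition smooth :: "(real \<Rightarrow> real) \<Rightarrow> bool" where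
  "smooth f \<longleftrightarrow> (\<forall>k::nat. (deriv ^^ k) f differentiable_on UNIV)"

definition det2 :: "int \<times> int \<Rightarrow> int \<times> int \<Rightarrow> int" where
  "det2 u v = fst u * snd v - snd u * fst v"

definition lattice_basis :: "int \<times> int \<Rightarrow> int \<times> int \<Rightarrow> (int \<times> int) set \<Rightarrow> bool" where
  "lattice_basis u v L \<longleftrightarrow> det2 u v \<noteq> 0 \<and>
     L = {(a * fst u + b * fst v, a * snd u + b * snd v) | a b. True}"

definition full_rank_lattice :: "(int \<times> int) set \<Rightarrow> bool" where
  "full_rank_lattice L \<longleftrightarrow> (\<exists>u v. lattice_basis u v L)"

definition lattice_det :: "(int \<times> int) set \<Rightarrow> int" where
  "lattice_det L = (THE d. \<exists>u v. lattice_basis u v L \<and> d = \<bar>det2 u v\<bar>)"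

lemma lattice_basis_det_dvd:
  assumes "lattice_basis u v L" "u' \<in> L" "v' \<in> L"
  shows "det2 u v dvd det2 u' v'"
proof -
  from assms obtain a b c d where
    "u' = (a * fst u + b * fst v, a * snd u + b * snd v)"
    "v' = (c * fst u + d * fst v, c * snd u + d * snd v)"
    by (auto simp: lattice_basis_def)
  then have "det2 u' v' = det2 u v * (a * d - b * c)"
    by (simp add: det2_def algebra_simps)
  then show ?thesis by simp
qed

lemma lattice_basis_mem:
  assumes "lattice_basis u v L"
  shows "u \<in> L" "v \<in> L"
proof -
  have "u = (1 * fst u + 0 * fst v, 1 * snd u + 0 * snd v)"
    and "v = (0 * fst u + 1 * fst v, 0 * snd u + 1 * snd v)"
    by simp_all
  then show "u \<in> L" "v \<in> L"
    using assms unfolding lattice_basis_def by blast+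
qed

text \<open>The determinant does not depend on the basis, so the description in
  \<^const>\<open>lattice_det\<close> is proper.\<close>

lemma lattice_det_eq:
  assumes "lattice_basis u v L"
  shows "lattice_det L = \<bar>det2 u v\<bar>"
  unfolding lattice_det_def
proof (rule the_equality)
  show "\<exists>u' v'. lattice_basis u' v' L \<and> \<bar>det2 u v\<bar> = \<bar>det2 u' v'\<bar>"
    using assms by blast
next
  fix d assume "\<exists>u' v'. lattice_basis u' v' L \<and> d = \<bar>det2 u' v'\<bar>"
  then obtain u' v' where B: "lattice_basis u' v' L" and d: "d = \<bar>det2 u' v'\<bar>"
    by blast
  have "det2 u v dvd det2 u' v'" "det2 u' v' dvd det2 u v"
    using assms B lattice_basis_det_dvd lattice_basis_mem by blast+
  then show "d = \<bar>det2 u v\<bar>"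
    unfolding d by (rule zdvd_antisym_abs[symmetric])
qed

definition euclid_len :: "int \<times> int \<Rightarrow> real" where
  "euclid_len v = norm (real_of_int (fst v), real_of_int (snd v))"

definition int_multiples :: "int \<times> int \<Rightarrow> (int \<times> int) set" where
  "int_multiples v = {(k * fst v, k * snd v) | k. True}"

text \<open>A reduced basis is in general not unique: this predicate describes all admissible choices.\<close>

definition reduced_basis :: "(int \<times> int) set \<Rightarrow> int \<times> int \<Rightarrow> int \<times> int \<Rightarrow> bool" where
  "reduced_basis L b1 b2 \<longleftrightarrow>
     b1 \<in> L \<and> b1 \<noteq> (0, 0) \<and>
     (\<forall>v\<in>L. v \<noteq> (0, 0) \<longrightarrow> euclid_len b1 \<le> euclid_len v) \<and>
     b2 \<in> L \<and> b2 \<notin> int_multiples b1 \<and>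
     (\<forall>v\<in>L. v \<notin> int_multiples b1 \<longrightarrow> euclid_len b2 \<le> euclid_len v) \<and>
     0 \<le> fst b1 \<and> det2 b1 b2 = lattice_det L"

text \<open>Only finitely many terms of the following sum are nonzero when \<open>W\<close> has compact support,
  but its index set is infinite, hence the infinite-sum operator.\<close>

definition psi ::
  "(real \<Rightarrow> real) \<Rightarrow> (int \<times> int) set \<Rightarrow> real \<Rightarrow> (nat \<Rightarrow> complex) \<Rightarrow> complex" where
  "psi W L N \<alpha> =
     (\<Sum>\<^sub>\<infinity>(m, n)\<in>{(m, n). (m, n) \<in> L \<and> 0 < m \<and> real_of_int m \<le> N}.
        \<alpha> (nat m) * complex_of_real (W (real_of_int n / N)))"

text \<open>\<open>B1 L\<close> and \<open>B2 L\<close> are the rows of the chosen reduced basis matrix of \<open>L\<close>.\<close>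

definition admissible_family ::
  "real \<Rightarrow> real \<Rightarrow> (int \<times> int) set set \<Rightarrow>
   ((int \<times> int) set \<Rightarrow> int \<times> int) \<Rightarrow> ((int \<times> int) set \<Rightarrow> int \<times> int) \<Rightarrow> bool" where
  "admissible_family D M1 \<Lambda> B1 B2 \<longleftrightarrow>
     (\<forall>L\<in>\<Lambda>. full_rank_lattice L \<and>
        D \<le> real_of_int (lattice_det L) \<and> real_of_int (lattice_det L) < 2 * D \<and>
        Gcd (fst ` L) = 1 \<and>
        reduced_basis L (B1 L) (B2 L) \<and>
        M1 \<le> real_of_int (fst (B1 L)) \<and> real_of_int (fst (B1 L)) < 2 * M1) \<and>
     (\<forall>m::int. M1 \<le> real_of_int m \<and> real_of_int m < 2 * M1 \<longrightarrow>
        (\<forall>L\<in>\<Lambda>. \<forall>L'\<in>\<Lambda>. fst (B1 L) = m \<and> fst (B1 L') = m \<longrightarrow> L = L'))"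

text \<open>Hence finite sums over an admissible family carry no hidden convention.\<close>

lemma admissible_family_finite:
  assumes "admissible_family D M1 \<Lambda> B1 B2"
  shows "finite \<Lambda>"
proof (rule finite_imageD)
  have "(\<lambda>L. fst (B1 L)) ` \<Lambda> \<subseteq> {\<lfloor>M1\<rfloor>..\<lceil>2 * M1\<rceil>}"
    using assms unfolding admissible_family_def by (fastforce simp: floor_le_iff le_ceiling_iff)
  then show "finite ((\<lambda>L. fst (B1 L)) ` \<Lambda>)"
    by (rule finite_subset) simp
  show "inj_on (\<lambda>L. fst (B1 L)) \<Lambda>"
    using assms unfolding admissible_family_def inj_on_def by metis
qed

end

theory Submission
  imports Defs
begin

text \<open>
  The gcd condition makes each lattice a set \<open>{(m, n). n \<equiv> c m (mod q)}\<close> with \<open>q = det \<lambda>\<close>, so \<open>\<psi>\<close> is a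
  sum over \<open>m\<close> of sums of \<open>W (n / N)\<close> over residue classes modulo \<open>q\<close>.

  For small \<open>q\<close>, the function \<open>x \<mapsto> \<Sum>n. W ((n + x) / X)\<close> with \<open>X = N / q\<close> is periodic; its derivatives
  vanish somewhere in each period, so iterating the mean value theorem shows that it differs from its
  mean \<open>X \<integral>W\<close> by \<open>O (X powr (1 - k))\<close> for every \<open>k\<close>.

  For large \<open>q\<close>, detect the residue class by additive characters modulo \<open>q\<close>. The quasi-periodicity of
  twisted sums shows that frequencies \<open>h / q\<close> with \<open>\<bar>h\<bar> > H = D N powr (\<delta> - 1)\<close> are negligible. If \<open>(m, b)\<close>
  is the shortest vector, then \<open>c / q = y / m + b / (q m)\<close> with \<open>y\<close> coprime to \<open>m\<close>. Partial summation
  removes \<open>b / (q m)\<close>, which is small because \<open>m\<^sup>2 + b\<^sup>2 \<le> 2 q\<close>. Since \<open>H < M1 \<le> m\<close> and the \<open>m\<close> are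
  distinct, the points \<open>h y / m\<close> with \<open>gcd h m = g\<close> are \<open>(g / (2 M1))\<^sup>2\<close>-spaced modulo 1, and summing the
  resulting large sieve bound over \<open>g\<close> gives the claim.
\<close>

section \<open>Sums of smooth functions over shifted integers\<close>

lemma smooth_has_higher_deriv:
  assumes "smooth W"
  shows "((deriv ^^ k) W has_real_derivative (deriv ^^ Suc k) W t) (at t)"
proof -
  have "(deriv ^^ k) W differentiable (at t)"
    using assms unfolding smooth_def differentiable_on_def by simp
  then show ?thesis
    by (simp add: DERIV_deriv_iff_real_differentiable)
qed

text \<open>The complement of \<open>{0..1}\<close> is open and each derivative vanishes identically
  on it, so the next derivative vanishes there too.\<close>

lemma higher_deriv_eq_0_outside_support:
  fixes W :: "real \<Rightarrow> real"
  assumes "closure {t. W t \<noteq> 0} \<subseteq> {0..1}" "t \<notin> {0..1}"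
  shows "(deriv ^^ k) W t = 0"
  using assms(2)
proof (induction k arbitrary: t)
  case 0
  then show ?case using assms(1) closure_subset[of "{t. W t \<noteq> 0}"] by auto
next
  case (Suc k)
  have op: "open (- {0..1::real})" by (intro open_Compl closed_atLeastAtMost)
  have "((\<lambda>_. 0) has_real_derivative 0) (at t)" by simp
  then have "((deriv ^^ k) W has_real_derivative 0) (at t)"
    by (rule has_field_derivative_transform_within_open[OF _ op]) (use Suc in auto)
  then show ?case by (simp add: DERIV_imp_deriv)
qed

text \<open>Shifting drops the left end term and brings in one just past the right end, and both are
  zero. This makes sums over a fixed window invariant under translation of the index.\<close>

lemma sum_window_shift:
  fixes g :: "int \<Rightarrow> 'a::comm_monoid_add"
  assumes "a \<le> b" "g a = 0" "g (b + 1) = 0"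
  shows "(\<Sum>n\<in>{a..b}. g (n + 1)) = (\<Sum>n\<in>{a..b}. g n)"
proof -
  have "(\<Sum>n\<in>{a..b}. g (n + 1)) = (\<Sum>n\<in>{a+1..b+1}. g n)"
    by (rule sum.reindex_bij_witness[of _ "\<lambda>n. n - 1" "\<lambda>n. n + 1"]) auto
  also have "{a+1..b+1} = insert (b + 1) {a+1..b}" using assms by auto
  also have "sum g \<dots> = sum g (insert a {a+1..b})" using assms by simp
  also have "insert a {a+1..b} = {a..b}" using assms by auto
  finally show ?thesis .
qed

text \<open>The mean value inequality in the form needed for complex-valued functions of a real
  variable, where an intermediate point need not exist.\<close>

lemma norm_diff_le_vector_derivative:
  fixes f :: "real \<Rightarrow> 'a::real_normed_vector"
  assumes "convex S" "\<And>x. x \<in> S \<Longrightarrow> (f has_vector_derivative f' x) (at x within S)"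
    "\<And>x. x \<in> S \<Longrightarrow> norm (f' x) \<le> B" "x \<in> S" "y \<in> S"
  shows "norm (f x - f y) \<le> B * norm (x - y)"
proof (rule differentiable_bound[OF assms(1) _ _ assms(4,5)])
  show "(f has_derivative (\<lambda>h. h *\<^sub>R f' x)) (at x within S)" if "x \<in> S" for x
    using assms(2)[OF that] by (simp add: has_vector_derivative_def)
  show "onorm (\<lambda>h. h *\<^sub>R f' x) \<le> B" if "x \<in> S" for x
    using assms(3)[OF that] by (intro onorm_le) (simp add: mult.commute[of B] mult_left_mono)
qed

text \<open>A smooth weight and all its derivatives form one sequence, so that inductions can gain a
  power of the scale by stepping from level \<open>k\<close> to level \<open>Suc k\<close>.\<close>

locale derivative_tower =
  fixes w :: "nat \<Rightarrow> real \<Rightarrow> real"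
  assumes has_deriv: "(w k has_real_derivative w (Suc k) t) (at t)"
    and support: "t \<notin> {0..1} \<Longrightarrow> w k t = 0"
begin

lemma continuous: "continuous_on S (w k)"
  by (meson DERIV_isCont continuous_at_imp_continuous_on has_deriv)

lemma bounded: "\<exists>C>0. \<forall>t. \<bar>w k t\<bar> \<le> C"
proof -
  have "compact (w k ` {0..1})"
    by (intro compact_continuous_image continuous compact_Icc)
  then obtain C where C: "C > 0" "\<And>t. t \<in> {0..1} \<Longrightarrow> \<bar>w k t\<bar> \<le> C"
    by (metis bounded_pos compact_imp_bounded imageI real_norm_def)
  then have "\<bar>w k t\<bar> \<le> C" for t
    using support[of t k] by (cases "t \<in> {0..1}") auto
  with C show ?thesis by blast
qed

text \<open>For \<open>X > 0\<close> and a shift \<open>x\<close> between 0 and 2, every integer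
  \<open>n\<close> with \<open>(n + x) / X\<close> in \<open>{0..1}\<close> lies in this range, so
  sums over it equal sums over all integers. Since the range does not depend on \<open>x\<close>,
  they can be differentiated term by term.\<close>

definition window :: "real \<Rightarrow> int set" where
  "window X = {-2..\<lceil>X\<rceil> + 1}"

definition shift_sum :: "nat \<Rightarrow> real \<Rightarrow> real \<Rightarrow> real" where
  "shift_sum k X x = (\<Sum>n\<in>window X. w k ((of_int n + x) / X))"

definition twisted_sum :: "nat \<Rightarrow> real \<Rightarrow> real \<Rightarrow> real \<Rightarrow> complex" where
  "twisted_sum k X \<theta> x =
     (\<Sum>n\<in>window X. of_real (w k ((of_int n + x) / X)) * cis (- (2 * pi * \<theta> * of_int n)))"

lemma card_window:
  assumes "X \<ge> 1/2"
  shows "real (card (window X)) \<le> 11 * X"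
proof -
  have "real (card (window X)) = of_int \<lceil>X\<rceil> + 4"
    using assms by (simp add: window_def)
  \<comment> \<open>The ceiling adds less than 1, and \<open>5 \<le> 10 * X\<close> because
    \<open>X \<ge> 1/2\<close>.\<close>
  also have "\<dots> \<le> 11 * X" using assms by linarith
  finally show ?thesis .
qed

lemma finite_window [simp]: "finite (window X)"
  by (simp add: window_def)

lemma shift_sum_bound:
  assumes "X \<ge> 1/2" "\<And>t. \<bar>w k t\<bar> \<le> C"
  shows "\<bar>shift_sum k X x\<bar> \<le> 11 * X * C"
proof -
  have "C \<ge> 0" using assms(2)[of 0] by linarith
  have "\<bar>shift_sum k X x\<bar> \<le> (\<Sum>n\<in>window X. C)"
    unfolding shift_sum_def by (rule order_trans[OF sum_abs sum_mono]) (rule assms)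
  also have "\<dots> \<le> 11 * X * C"
    using mult_right_mono[OF card_window[OF assms(1)] \<open>C \<ge> 0\<close>] by simp
  finally show ?thesis .
qed

lemma twisted_sum_bound:
  assumes "X \<ge> 1/2" "\<And>t. \<bar>w k t\<bar> \<le> C"
  shows "norm (twisted_sum k X \<theta> x) \<le> 11 * X * C"
proof -
  have "C \<ge> 0" using assms(2)[of 0] by linarith
  have "norm (twisted_sum k X \<theta> x) \<le> (\<Sum>n\<in>window X. C)"
    unfolding twisted_sum_def
    by (rule order_trans[OF norm_sum sum_mono]) (use assms in \<open>simp add: norm_mult\<close>)
  also have "\<dots> \<le> 11 * X * C"
    using mult_right_mono[OF card_window[OF assms(1)] \<open>C \<ge> 0\<close>] by simp
  finally show ?thesis .
qed

section \<open>Differentiation in the shift, periodicity and quasi-periodicity\<close>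

lemma has_deriv_shift:
  assumes "X > 0"
  shows "((\<lambda>x. w k ((of_int n + x) / X)) has_real_derivative w (Suc k) ((of_int n + x) / X) / X) (at x)"
proof -
  have "((\<lambda>x. (of_int n + x) / X) has_real_derivative 1 / X) (at x)"
    using assms by (auto intro!: derivative_eq_intros)
  from DERIV_chain2[OF has_deriv this] show ?thesis by simp
qed

lemma has_deriv_shift_sum:
  assumes "X > 0"
  shows "(shift_sum k X has_real_derivative shift_sum (Suc k) X x / X) (at x)"
  unfolding shift_sum_def sum_divide_distrib
  by (rule DERIV_sum) (rule has_deriv_shift[OF assms])

lemma has_deriv_twisted_sum:
  assumes "X > 0"
  shows "(twisted_sum k X \<theta> has_vector_derivative twisted_sum (Suc k) X \<theta> x / of_real X) (at x)"
proof -
  have "((\<lambda>x. of_real (w k ((of_int n + x) / X)) * cis (- (2 * pi * \<theta> * of_int n)))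
      has_vector_derivative
      of_real (w (Suc k) ((of_int n + x) / X) / X) * cis (- (2 * pi * \<theta> * of_int n))) (at x)" for n
    using has_deriv_shift[OF assms, of k n x]
    by (intro has_vector_derivative_mult_left has_vector_derivative_of_real)
      (simp add: has_real_derivative_iff_has_vector_derivative)
  then have "(twisted_sum k X \<theta> has_vector_derivative
      (\<Sum>n\<in>window X. of_real (w (Suc k) ((of_int n + x) / X) / X) * cis (- (2 * pi * \<theta> * of_int n)))) (at x)"
    unfolding twisted_sum_def by (intro has_vector_derivative_sum) auto
  then show ?thesis by (simp add: twisted_sum_def sum_divide_distrib)
qed

lemma window_ends:
  assumes "X > 0" "0 \<le> x" "x \<le> 1"
  shows "w k ((of_int (-2) + x) / X) = 0" "w k ((of_int (\<lceil>X\<rceil> + 1 + 1) + x) / X) = 0"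
proof -
  have "(of_int (-2) + x) / X < 0" using assms by (simp add: field_simps)
  then show "w k ((of_int (-2) + x) / X) = 0" by (intro support) auto
  have "(of_int (\<lceil>X\<rceil> + 1 + 1) + x) / X > 1" using assms by (simp add: field_simps; linarith)
  then show "w k ((of_int (\<lceil>X\<rceil> + 1 + 1) + x) / X) = 0" by (intro support) auto
qed

lemma shift_sum_periodic:
  assumes "X > 0"
  shows "shift_sum k X 1 = shift_sum k X 0"
proof -
  have "(\<Sum>n\<in>window X. w k ((of_int (n + 1) + 0) / X)) = (\<Sum>n\<in>window X. w k ((of_int n + 0) / X))"
    unfolding window_def using window_ends[OF assms, of 0 k] assms
    by (intro sum_window_shift) auto
  then show ?thesis by (simp add: shift_sum_def)
qed

text \<open>Adding 1 to the shift is undone by reindexing \<open>n + 1\<close> as \<open>n\<close>,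
  which costs one step of the character.\<close>

lemma twisted_sum_quasi_periodic:
  assumes "X > 0" "0 \<le> x" "x \<le> 1"
  shows "twisted_sum k X \<theta> (x + 1) = cis (2 * pi * \<theta>) * twisted_sum k X \<theta> x"
proof -
  let ?g = "\<lambda>n. of_real (w k ((of_int n + x) / X)) * cis (- (2 * pi * \<theta> * of_int n))"
  have "twisted_sum k X \<theta> (x + 1) = (\<Sum>n\<in>window X. cis (2 * pi * \<theta>) * ?g (n + 1))"
    unfolding twisted_sum_def
    by (intro sum.cong refl) (simp add: cis_mult algebra_simps)
  also have "\<dots> = cis (2 * pi * \<theta>) * (\<Sum>n\<in>window X. ?g (n + 1))"
    by (simp add: sum_distrib_left)
  also have "(\<Sum>n\<in>window X. ?g (n + 1)) = (\<Sum>n\<in>window X. ?g n)"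
    unfolding window_def using window_ends[OF assms, of k] assms
    by (intro sum_window_shift) (auto simp: add.assoc)
  finally show ?thesis by (simp add: twisted_sum_def)
qed

text \<open>A substitute for \<open>j\<close>-fold integration by parts. By quasi-periodicity,
  \<open>cis (2 * pi * \<theta>) - 1\<close> times the value at \<open>x\<close> is the increment
  from \<open>x\<close> to \<open>x + 1\<close>, and the mean value inequality bounds this by
  \<open>1 / X\<close> times the next level. Each iteration gains one factor
  \<open>X * norm (cis (2 * pi * \<theta>) - 1)\<close>.\<close>

lemma twisted_sum_decay:
  assumes X: "X \<ge> 1/2" and x: "0 \<le> x" "x \<le> 1" and C: "\<And>t. \<bar>w (k + j) t\<bar> \<le> C"
  shows "norm (twisted_sum k X \<theta> x) * (X * norm (cis (2 * pi * \<theta>) - 1)) ^ j \<le> 11 * X * C"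
  using x C
proof (induction j arbitrary: k x)
  case 0
  then show ?case using twisted_sum_bound[OF X] by simp
next
  case (Suc j)
  let ?r = "X * norm (cis (2 * pi * \<theta>) - 1)"
  have X0: "X > 0" using X by simp
  have r0: "?r \<ge> 0" using X0 by simp
  show ?case
  proof (cases "?r = 0")
    case True
    have "C \<ge> 0" using Suc.prems(3)[of 0] by linarith
    with True X0 show ?thesis by simp
  next
    case False
    define B where "B = 11 * X * C / ?r ^ j"
    have B: "norm (twisted_sum (Suc k) X \<theta> z) \<le> B" if "0 \<le> z" "z \<le> 1" for z
    proof -
      have "norm (twisted_sum (Suc k) X \<theta> z) * ?r ^ j \<le> 11 * X * C"
        using Suc.IH[of z "Suc k"] Suc.prems(3) that by simp
      moreover have "?r ^ j > 0" using False r0 by (intro zero_less_power) linarith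
      ultimately show ?thesis unfolding B_def by (subst pos_le_divide_eq)
    qed
    \<comment> \<open>The interval from \<open>x\<close> to \<open>x + 1\<close> leaves
      \<open>{0..1}\<close>. The bound extends to \<open>{0..2}\<close> because the quasi-period
      factor has norm 1.\<close>
    have B2: "norm (twisted_sum (Suc k) X \<theta> z) \<le> B" if "0 \<le> z" "z \<le> 2" for z
    proof (cases "z \<le> 1")
      case False
      then show ?thesis using twisted_sum_quasi_periodic[OF X0, of "z - 1" "Suc k" \<theta>] B[of "z - 1"] that
        by (simp add: norm_mult)
    qed (use B that in auto)
    have "norm (twisted_sum k X \<theta> (x + 1) - twisted_sum k X \<theta> x) \<le> B / X * norm (x + 1 - x)"
    proof (rule norm_diff_le_vector_derivative[of "{x..x+1}" _ "\<lambda>z. twisted_sum (Suc k) X \<theta> z / of_real X"])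
      show "norm (twisted_sum (Suc k) X \<theta> z / of_real X) \<le> B / X" if "z \<in> {x..x+1}" for z
        using B2[of z] that X0 Suc.prems by (simp add: norm_divide divide_right_mono)
    qed (use has_deriv_twisted_sum[OF X0] in \<open>auto intro: has_vector_derivative_at_within\<close>)
    also have "twisted_sum k X \<theta> (x + 1) - twisted_sum k X \<theta> x
        = (cis (2 * pi * \<theta>) - 1) * twisted_sum k X \<theta> x"
      using twisted_sum_quasi_periodic[OF X0 Suc.prems(1,2)] by (simp add: algebra_simps)
    finally have "norm (twisted_sum k X \<theta> x) * ?r \<le> B"
      using X0 by (simp add: norm_mult pos_le_divide_eq mult_ac)
    then have "norm (twisted_sum k X \<theta> x) * ?r * ?r ^ j \<le> B * ?r ^ j"
      using r0 by (intro mult_right_mono) auto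
    then show ?thesis using False by (simp add: B_def mult_ac)
  qed
qed

section \<open>Approximation of untwisted sums by their mean\<close>

lemma shift_sum_oscillation:
  assumes "X > 0" "\<And>x. x \<in> {0..1} \<Longrightarrow> \<bar>shift_sum (Suc k) X x\<bar> \<le> B"
    "z \<in> {0..1}" "x \<in> {0..1}"
  shows "\<bar>shift_sum k X x - shift_sum k X z\<bar> \<le> B / X"
proof -
  have "norm (shift_sum k X x - shift_sum k X z) \<le> B / X * norm (x - z)"
  proof (rule field_differentiable_bound[of "{0..1}"])
    show "norm (shift_sum (Suc k) X y / X) \<le> B / X" if "y \<in> {0..1}" for y
      using assms(1) assms(2)[OF that] by (simp add: divide_right_mono)
  qed (use assms has_deriv_shift_sum in \<open>auto intro: has_field_derivative_at_within\<close>)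
  also have "\<dots> \<le> B / X * 1"
  proof (rule mult_left_mono)
    show "norm (x - z) \<le> 1" using assms(3,4) by auto
    show "0 \<le> B / X" using assms(1) assms(2)[OF assms(3)] by simp
  qed
  finally show ?thesis by simp
qed

text \<open>Rolle's theorem over one period.\<close>

lemma shift_sum_Suc_has_zero:
  assumes "X > 0"
  shows "\<exists>z\<in>{0..1}. shift_sum (Suc k) X z = 0"
proof -
  obtain z where "0 < z" "z < 1" "shift_sum k X 1 - shift_sum k X 0 = (1 - 0) * (shift_sum (Suc k) X z / X)"
    using MVT2[of 0 1 "shift_sum k X" "\<lambda>x. shift_sum (Suc k) X x / X"]
      has_deriv_shift_sum[OF assms] by auto
  then show ?thesis using shift_sum_periodic[OF assms] assms by auto
qed

text \<open>A derivative of a periodic sum has a zero in each period, so its size is at most its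
  oscillation, hence at most \<open>1 / X\<close> times the bound for the next level. The iteration
  ends with the trivial bound \<open>11 * X * C\<close>.\<close>

lemma shift_sum_Suc_bound:
  assumes X: "X \<ge> 1/2" and "x \<in> {0..1}" "\<And>t. \<bar>w (Suc k + j) t\<bar> \<le> C"
  shows "\<bar>shift_sum (Suc k) X x\<bar> \<le> 11 * X * C / X ^ j"
  using assms(2,3)
proof (induction j arbitrary: k x)
  case 0
  then show ?case using shift_sum_bound[OF X] by simp
next
  case (Suc j)
  have X0: "X > 0" using X by simp
  obtain z where z: "z \<in> {0..1}" "shift_sum (Suc k) X z = 0"
    using shift_sum_Suc_has_zero[OF X0] by blast
  have "\<bar>shift_sum (Suc k) X x - shift_sum (Suc k) X z\<bar> \<le> 11 * X * C / X ^ j / X"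
    using Suc.IH[of _ "Suc k"] Suc.prems z X0 by (intro shift_sum_oscillation) auto
  then show ?case using z by (simp add: mult_ac)
qed

text \<open>The mean value theorem is applied to a sum of shifted primitives of \<open>w 0\<close>; its increment over
  a period telescopes to the full integral.\<close>

lemma shift_sum_attains_mean:
  assumes X: "X \<ge> 1/2"
  shows "\<exists>z\<in>{0..1}. shift_sum 0 X z = X * integral UNIV (w 0)"
proof -
  have X0: "X > 0" using X by simp
  \<comment> \<open>All arguments that occur are at least \<open>-2 / X \<ge> -4\<close>, so the
    lower limit -5 keeps them strictly inside the range where \<open>V\<close> is
    differentiable.\<close>
  define V where "V t = integral {-5..t} (w 0)" for t
  have V: "(V has_real_derivative w 0 t) (at t)" if "t > -5" for t
  proof -
    have "(V has_real_derivative w 0 t) (at t within {-5..t+1})"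
      unfolding V_def using that by (intro integral_has_real_derivative continuous) auto
    moreover have "at t within {-5..t+1} = at t"
      using that by (intro at_within_interior) (auto simp: interior_atLeastAtMost_real)
    ultimately show ?thesis by simp
  qed
  define P where "P x = X * (\<Sum>n\<in>window X. V ((of_int n + x) / X))" for x
  have dP: "(P has_real_derivative shift_sum 0 X x) (at x)" if "0 \<le> x" "x \<le> 1" for x
  proof -
    have "((\<lambda>x. V ((of_int n + x) / X)) has_real_derivative w 0 ((of_int n + x) / X) * (1 / X)) (at x)"
      if n: "n \<in> window X" for n
    proof (rule DERIV_chain2[OF V])
      have "of_int n \<ge> (-2::real)" using n by (simp add: window_def)
      then show "(of_int n + x) / X > -5"
        using \<open>0 \<le> x\<close> X by (simp add: field_simps)
      show "((\<lambda>x. (of_int n + x) / X) has_real_derivative 1 / X) (at x)"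
        using X0 by (auto intro!: derivative_eq_intros)
    qed
    then have "((\<lambda>x. \<Sum>n\<in>window X. V ((of_int n + x) / X)) has_real_derivative
        (\<Sum>n\<in>window X. w 0 ((of_int n + x) / X) * (1 / X))) (at x)"
      by (intro DERIV_sum) auto
    from DERIV_cmult[OF this, of X] show ?thesis
      using X0 by (simp add: P_def[abs_def] shift_sum_def sum_distrib_left)
  qed
  have "\<exists>z. z > 0 \<and> z < 1 \<and> P 1 - P 0 = (1 - 0) * shift_sum 0 X z"
    using dP by (intro MVT2) auto
  then obtain z where z: "0 < z" "z < 1" "P 1 - P 0 = shift_sum 0 X z" by auto
  define b where "b = \<lceil>X\<rceil> + 1"
  have "V (of_int (-2) / X) = 0"
  proof -
    have "V (of_int (-2) / X) = integral {-5..of_int (-2) / X} (\<lambda>_. 0)"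
      unfolding V_def
    proof (rule integral_cong)
      fix t assume "t \<in> {-5..of_int (-2) / X}"
      moreover have "of_int (-2) / X < 0" using X0 by (simp add: field_simps)
      ultimately show "w 0 t = 0" by (intro support) (metis atLeastAtMost_iff not_le order_trans)
    qed
    then show ?thesis by simp
  qed
  moreover have "V (of_int (b + 1) / X) = integral UNIV (w 0)"
  proof -
    have b1: "of_int (b + 1) / X > 1" using X0 unfolding b_def by (simp add: field_simps; linarith)
    have "w 0 = (\<lambda>t. if t \<in> {-5..of_int (b + 1) / X} then w 0 t else 0)"
    proof
      fix t show "w 0 t = (if t \<in> {-5..of_int (b + 1) / X} then w 0 t else 0)"
        using support[of t 0] b1 by (cases "t \<in> {0..1}") auto
    qed
    then show ?thesis unfolding V_def by (metis integral_restrict_UNIV)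
  qed
  moreover have "(\<Sum>n\<in>{-2..b}. V (of_int (n + 1) / X)) - (\<Sum>n\<in>{-2..b}. V (of_int n / X))
      = V (of_int (b + 1) / X) - V (of_int (-2) / X)"
  proof -
    have "b \<ge> -2" using X0 by (simp add: b_def; linarith)
    then show ?thesis
    proof (induction b rule: int_ge_induct)
      case (step i)
      have "{-2..i+1} = insert (i + 1) {-2..i}" using step by auto
      then show ?case using step by simp
    qed simp
  qed
  ultimately have "P 1 - P 0 = X * integral UNIV (w 0)"
    by (simp add: P_def window_def b_def algebra_simps flip: right_diff_distrib)
  then show ?thesis using z by (intro bexI[of _ z]) auto
qed

text \<open>The mean is attained somewhere in the period, so the deviation from it is at most the
  oscillation, which the first-level bound controls.\<close>

lemma shift_sum_approx:
  assumes X: "X \<ge> 1/2" and "x \<in> {0..1}" "\<And>t. \<bar>w (Suc k) t\<bar> \<le> C"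
  shows "\<bar>shift_sum 0 X x - X * integral UNIV (w 0)\<bar> \<le> 11 * X * C / X ^ Suc k"
proof -
  have X0: "X > 0" using X by simp
  obtain z where z: "z \<in> {0..1}" "shift_sum 0 X z = X * integral UNIV (w 0)"
    using shift_sum_attains_mean[OF X] by blast
  have "\<bar>shift_sum 0 X x - shift_sum 0 X z\<bar> \<le> 11 * X * C / X ^ k / X"
    using shift_sum_Suc_bound[OF X, of _ 0 k C] assms(2,3) z X0
    by (intro shift_sum_oscillation) auto
  then show ?thesis using z by (simp add: mult_ac)
qed

end

section \<open>Exponential sums and a large sieve bound\<close>

lemma norm_cis_minus_1: "norm (cis t - 1) = 2 * \<bar>sin (t / 2)\<bar>"
  using dist_exp_i_1[of t] by (simp add: cis_conv_exp)

lemma norm_cis_minus_1_le: "norm (cis t - 1) \<le> \<bar>t\<bar>"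
  using abs_sin_x_le_abs_x[of "t / 2"] by (simp add: norm_cis_minus_1)

text \<open>Jordan's inequality with a weaker constant: the chord is
  \<open>2 * \<bar>sin (pi * s)\<bar>\<close>, and the cubic Taylor bound gives
  \<open>sin x \<ge> x / 2\<close> on the relevant range.\<close>

lemma norm_cis_minus_1_ge:
  assumes "\<bar>s\<bar> \<le> 1/2"
  shows "2 * \<bar>s\<bar> \<le> norm (cis (2 * pi * s) - 1)"
proof -
  define x where "x = pi * \<bar>s\<bar>"
  have "x \<le> pi * (1/2)" unfolding x_def using assms by (intro mult_left_mono) auto
  \<comment> \<open>Half of \<open>pi\<close> is below 1.6, and \<open>1.6 ^ 2 \<le> 3\<close> makes
    the cubic error at most half of the linear term.\<close>
  then have "x \<le> 1.6" using pi_less_4 pi_approx by simp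
  moreover have "0 \<le> x" by (simp add: x_def)
  ultimately have x: "0 \<le> x" "x \<le> 1.6" by auto
  have "\<bar>sin x - x\<bar> \<le> x ^ 3 / 6"
    using Maclaurin_sin_bound[of x 3] x(1)
    by (simp add: numeral_3_eq_3 sin_coeff_def fact_numeral)
  then have "x - x ^ 3 / 6 \<le> sin x" by linarith
  moreover have "x ^ 3 \<le> 3 * x"
  proof -
    have "x ^ 2 \<le> 1.6 ^ 2" using x by (intro power_mono) auto
    also have "\<dots> \<le> (3::real)" by (simp add: power2_eq_square)
    finally have "x * x ^ 2 \<le> x * 3" using x by (intro mult_left_mono) auto
    then show ?thesis by (simp add: power3_eq_cube power2_eq_square)
  qed
  ultimately have "x / 2 \<le> sin x" by linarith
  moreover have "\<bar>sin (pi * s)\<bar> = sin x"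
  proof -
    have "\<bar>sin (pi * s)\<bar> = \<bar>sin x\<bar>" by (cases "s \<ge> 0") (auto simp: x_def)
    then show ?thesis using \<open>x / 2 \<le> sin x\<close> x by simp
  qed
  moreover have "2 * \<bar>s\<bar> \<le> x" unfolding x_def using pi_gt3 by (intro mult_right_mono) auto
  ultimately show ?thesis by (simp add: norm_cis_minus_1)
qed

section \<open>Exponential sums with bounded coefficients\<close>

definition expsum :: "(nat \<Rightarrow> complex) \<Rightarrow> nat \<Rightarrow> real \<Rightarrow> complex" where
  "expsum \<alpha> t \<theta> = (\<Sum>m\<in>{1..t}. \<alpha> m * cis (2 * pi * real m * \<theta>))"

lemma norm_expsum_le:
  assumes "\<And>m. norm (\<alpha> m) \<le> 1"
  shows "norm (expsum \<alpha> t \<theta>) \<le> real t"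
proof -
  have "norm (expsum \<alpha> t \<theta>) \<le> (\<Sum>m\<in>{1..t}. 1)"
    unfolding expsum_def by (rule order_trans[OF norm_sum sum_mono]) (simp add: norm_mult assms)
  then show ?thesis by simp
qed

lemma expsum_add_int: "expsum \<alpha> t (\<theta> + of_int k) = expsum \<alpha> t \<theta>"
proof -
  have "cis (2 * pi * real m * (\<theta> + of_int k)) = cis (2 * pi * real m * \<theta>)" for m
  proof -
    have "cis (2 * pi * real m * (\<theta> + of_int k)) = cis (2 * pi * real m * \<theta>) * cis (2 * pi * of_int (int m * k))"
      by (simp add: cis_mult algebra_simps)
    also have "cis (2 * pi * of_int (int m * k)) = 1" by (rule cis_multiple_2pi) auto
    finally show ?thesis by simp
  qed
  then show ?thesis by (simp add: expsum_def)
qed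

text \<open>Negative frequencies become positive ones for the conjugate coefficients, which satisfy
  the same bound, so estimates for positive frequencies cover both signs.\<close>

lemma expsum_uminus: "norm (expsum \<alpha> t (- \<theta>)) = norm (expsum (\<lambda>m. cnj (\<alpha> m)) t \<theta>)"
proof -
  have "expsum \<alpha> t (- \<theta>) = cnj (expsum (\<lambda>m. cnj (\<alpha> m)) t \<theta>)"
    by (simp add: expsum_def cis_cnj)
  then show ?thesis by (simp only: complex_mod_cnj)
qed

lemma norm_expsum_1_le:
  assumes "s \<noteq> 0" "\<bar>s\<bar> \<le> 1/2"
  shows "norm (expsum (\<lambda>_. 1) t s) \<le> 1 / \<bar>s\<bar>"
proof -
  let ?z = "cis (2 * pi * s)"
  have pow: "cis (2 * pi * real m * s) = ?z ^ m" for m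
    by (simp only: Complex.DeMoivre mult_ac)
  have "expsum (\<lambda>_. 1) t s = (\<Sum>m\<in>{1..t}. ?z ^ m)"
    unfolding expsum_def pow by simp
  also have "(?z - 1) * \<dots> = ?z ^ Suc t - ?z"
    by (induction t) (simp_all add: algebra_simps)
  finally have "(?z - 1) * expsum (\<lambda>_. 1) t s = ?z ^ Suc t - ?z" .
  then have "norm (?z - 1) * norm (expsum (\<lambda>_. 1) t s) = norm (?z ^ Suc t - ?z)"
    by (metis norm_mult)
  also have "\<dots> \<le> 2"
    using norm_triangle_ineq4[of "?z ^ Suc t" ?z] by (simp add: norm_mult norm_power)
  finally have "norm (?z - 1) * norm (expsum (\<lambda>_. 1) t s) \<le> 2" .
  moreover have "2 * \<bar>s\<bar> * norm (expsum (\<lambda>_. 1) t s) \<le> norm (?z - 1) * norm (expsum (\<lambda>_. 1) t s)"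
    by (intro mult_right_mono norm_cis_minus_1_ge assms) auto
  ultimately show ?thesis using assms(1) by (simp add: field_simps)
qed

text \<open>Reduce the differences to \<open>\<bar>s\<bar> \<le> 1/2\<close> modulo 1 and cut the
  line into cells of width \<open>\<Delta>\<close>. Two points in one cell would violate the
  spacing, so each cell holds at most one. The two cells next to 0 get the trivial bound
  \<open>t\<close>, the others the geometric series bound, which adds up to a harmonic sum.\<close>

lemma sum_kernel_spaced:
  fixes x :: "'a \<Rightarrow> real"
  assumes fin: "finite P" and \<Delta>: "\<Delta> > 0" and n: "1 / (2 * \<Delta>) \<le> real n"
    and sp: "\<And>p p' k. p \<in> P \<Longrightarrow> p' \<in> P \<Longrightarrow> p \<noteq> p' \<Longrightarrow> \<Delta> \<le> \<bar>x p - x p' - of_int k\<bar>"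
  shows "(\<Sum>p\<in>P. norm (expsum (\<lambda>_. 1) t (x p - y))) \<le> 2 * real t + 2 / \<Delta> * harm n"
proof -
  define s where "s p = x p - y - of_int (round (x p - y))" for p
  define k where "k p = \<lfloor>s p / \<Delta>\<rfloor>" for p
  \<comment> \<open>Cell \<open>j\<close> is the interval from \<open>j * \<Delta>\<close> to
    \<open>(j + 1) * \<Delta>\<close>. A negative cell is nearest to 0 at its right end, whence
    \<open>- j - 1\<close>; cells 0 and -1 both touch 0.\<close>
  define B where "B j = (if j = 0 \<or> j = -1 then real t
      else if j > 0 then 1 / (of_int j * \<Delta>) else 1 / (of_int (- j - 1) * \<Delta>))" for j :: int
  have s: "\<bar>s p\<bar> \<le> 1/2" for p
    unfolding s_def using of_int_round_abs_le[of "x p - y"] by linarith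
  have k: "of_int (k p) * \<Delta> \<le> s p" "s p < (of_int (k p) + 1) * \<Delta>" for p
  proof -
    have "of_int (k p) \<le> s p / \<Delta>" "s p / \<Delta> < of_int (k p) + 1"
      using floor_correct[of "s p / \<Delta>"] by (auto simp: k_def)
    then show "of_int (k p) * \<Delta> \<le> s p" "s p < (of_int (k p) + 1) * \<Delta>"
      using \<Delta> by (auto simp: pos_le_divide_eq pos_divide_less_eq)
  qed
  have "inj_on k P"
  proof (rule inj_onI, rule ccontr)
    fix p p' assume p: "p \<in> P" "p' \<in> P" "k p = k p'" "p \<noteq> p'"
    have "\<bar>s p - s p'\<bar> < \<Delta>" using k[of p] k[of p'] p(3) by (simp add: algebra_simps)
    moreover have "s p - s p' = x p - x p' - of_int (round (x p - y) - round (x p' - y))"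
      by (simp add: s_def)
    ultimately show False using sp[OF p(1,2,4)] by (metis not_le)
  qed
  have "norm (expsum (\<lambda>_. 1) t (x p - y)) \<le> B (k p)" for p
  proof -
    have "norm (expsum (\<lambda>_. 1) t (x p - y)) = norm (expsum (\<lambda>_. 1) t (s p))"
      using expsum_add_int[of "\<lambda>_. 1" t "s p" "round (x p - y)"] by (simp add: s_def)
    also have "\<dots> \<le> B (k p)"
    proof -
      consider "k p = 0 \<or> k p = -1" | "k p > 0" | "k p < -1" by linarith
      then show ?thesis
      proof cases
        case 1
        then show ?thesis using norm_expsum_le[of "\<lambda>_. 1" t "s p"] by (auto simp: B_def)
      next
        case 2
        then have pos: "0 < of_int (k p) * \<Delta>" using \<Delta> by simp
        then have "s p > 0" using k(1)[of p] by linarith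
        then have "norm (expsum (\<lambda>_. 1) t (s p)) \<le> 1 / s p"
          using norm_expsum_1_le[of "s p" t] s[of p] by simp
        also have "\<dots> \<le> 1 / (of_int (k p) * \<Delta>)"
          using pos k(1)[of p] by (intro divide_left_mono) auto
        finally show ?thesis using 2 by (simp add: B_def)
      next
        case 3
        then have "of_int (k p) + 1 < (0::real)" by linarith
        then have pos: "0 < of_int (- k p - 1) * \<Delta>" using \<Delta> by simp
        have le: "of_int (- k p - 1) * \<Delta> \<le> - s p" using k(2)[of p] by (simp add: algebra_simps)
        then have "- s p > 0" using pos by linarith
        then have "norm (expsum (\<lambda>_. 1) t (s p)) \<le> 1 / (- s p)"
          using norm_expsum_1_le[of "s p" t] s[of p] by simp
        also have "\<dots> \<le> 1 / (of_int (- k p - 1) * \<Delta>)"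
          using le mult_pos_pos[OF \<open>- s p > 0\<close> pos] by (intro divide_left_mono) auto
        finally show ?thesis using 3 by (simp add: B_def)
      qed
    qed
    finally show ?thesis .
  qed
  then have "(\<Sum>p\<in>P. norm (expsum (\<lambda>_. 1) t (x p - y))) \<le> (\<Sum>p\<in>P. B (k p))"
    by (intro sum_mono)
  also have "\<dots> = sum B (k ` P)" using \<open>inj_on k P\<close> by (simp add: sum.reindex)
  also have "\<dots> \<le> sum B {- int n - 1..int n}"
  proof (rule sum_mono2)
    \<comment> \<open>The floors lie between \<open>- n\<close> and \<open>n\<close>; the extra cell
      makes the range symmetric under exchanging \<open>j\<close> and
      \<open>- j - 1\<close>.\<close>
    show "k ` P \<subseteq> {- int n - 1..int n}"
    proof
      fix j assume "j \<in> k ` P"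
      then obtain p where j: "j = k p" by blast
      have "\<bar>s p / \<Delta>\<bar> \<le> 1 / (2 * \<Delta>)" using s[of p] \<Delta> by (simp add: field_simps)
      then have "- real n \<le> s p / \<Delta>" "s p / \<Delta> \<le> real n" using n by linarith+
      then show "j \<in> {- int n - 1..int n}" unfolding j k_def by (simp, linarith)
    qed
    show "0 \<le> B b" for b
      using \<Delta> by (auto simp: B_def intro!: divide_nonneg_nonneg mult_nonneg_nonneg)
  qed simp
  also have "\<dots> = 2 * real t + 2 / \<Delta> * harm n"
  proof (induction n)
    case 0
    have "{- int 0 - 1..int 0} = {-1, 0}" by auto
    then show ?case by (simp add: B_def harm_def)
  next
    case (Suc n)
    have "{- int (Suc n) - 1..int (Suc n)} = insert (- int n - 2) (insert (int n + 1) {- int n - 1..int n})"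
      by auto
    then have "sum B {- int (Suc n) - 1..int (Suc n)} = B (- int n - 2) + B (int n + 1) + sum B {- int n - 1..int n}"
      by simp
    also have "B (- int n - 2) = 1 / (real (Suc n) * \<Delta>)" by (simp add: B_def)
    also have "B (int n + 1) = 1 / (real (Suc n) * \<Delta>)" by (simp add: B_def add.commute)
    finally have "sum B {- int (Suc n) - 1..int (Suc n)}
        = 2 * (1 / (real (Suc n) * \<Delta>)) + (2 * real t + 2 / \<Delta> * harm n)"
      using Suc by simp
    moreover have "2 / \<Delta> * harm (Suc n) = 2 * (1 / (real (Suc n) * \<Delta>)) + 2 / \<Delta> * harm n"
      by (simp only: harm_Suc inverse_eq_divide distrib_left) simp
    ultimately show ?case by simp
  qed
  finally show ?thesis .
qed

text \<open>The duality step of the large sieve: attach a phase to each point, exchange summations,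
  apply Cauchy-Schwarz over \<open>m\<close> to remove the coefficients, and expand the square into
  a kernel over pairs of points.\<close>

lemma sum_norm_expsum_le:
  assumes fin: "finite P" and \<alpha>: "\<And>m. norm (\<alpha> m) \<le> 1"
  shows "(\<Sum>p\<in>P. norm (expsum \<alpha> t (x p)))
    \<le> sqrt (real t * (\<Sum>p\<in>P. \<Sum>p'\<in>P. norm (expsum (\<lambda>_. 1) t (x p' - x p))))"
proof -
  \<comment> \<open>The phase that turns each absolute value into a linear expression in the
    coefficients.\<close>
  define u where "u p = cnj (sgn (expsum \<alpha> t (x p)))" for p
  define G where "G m = (\<Sum>p\<in>P. u p * cis (2 * pi * real m * x p))" for m
  define Y where "Y = (\<Sum>p\<in>P. norm (expsum \<alpha> t (x p)))"
  have u1: "norm (u p) \<le> 1" for p by (simp add: u_def norm_sgn)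
  have u2: "u p * expsum \<alpha> t (x p) = of_real (norm (expsum \<alpha> t (x p)))" for p
    using complex_norm_square[of "expsum \<alpha> t (x p)"]
    by (cases "expsum \<alpha> t (x p) = 0") (simp_all add: u_def sgn_eq divide_simps power2_eq_square mult_ac)
  have "complex_of_real Y = (\<Sum>p\<in>P. \<Sum>m\<in>{1..t}. \<alpha> m * (u p * cis (2 * pi * real m * x p)))"
    by (simp only: Y_def of_real_sum flip: u2) (simp only: expsum_def sum_distrib_left mult_ac)
  also have "\<dots> = (\<Sum>m\<in>{1..t}. \<alpha> m * G m)"
    by (subst sum.swap) (simp add: G_def sum_distrib_left)
  finally have "norm (complex_of_real Y) \<le> (\<Sum>m\<in>{1..t}. norm (\<alpha> m * G m))"
    by (metis norm_sum)
  also have "\<dots> \<le> (\<Sum>m\<in>{1..t}. 1 * norm (G m))"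
    unfolding norm_mult by (intro sum_mono mult_right_mono \<alpha>) auto
  finally have "\<bar>Y\<bar> \<le> (\<Sum>m\<in>{1..t}. 1 * norm (G m))" by simp
  then have "Y\<^sup>2 \<le> (\<Sum>m\<in>{1..t}. 1 * norm (G m))\<^sup>2"
    by (metis abs_le_square_iff abs_ge_zero abs_of_nonneg order_trans)
  also have "\<dots> \<le> (\<Sum>m\<in>{1..t}. 1\<^sup>2) * (\<Sum>m\<in>{1..t}. (norm (G m))\<^sup>2)"
    by (rule Cauchy_Schwarz_ineq_sum)
  also have "\<dots> = real t * (\<Sum>m\<in>{1..t}. (norm (G m))\<^sup>2)" by simp
  also have "(\<Sum>m\<in>{1..t}. (norm (G m))\<^sup>2) \<le> (\<Sum>p\<in>P. \<Sum>p'\<in>P. norm (expsum (\<lambda>_. 1) t (x p' - x p)))"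
  proof -
    have "complex_of_real ((norm (G m))\<^sup>2) =
        (\<Sum>p'\<in>P. \<Sum>p\<in>P. u p' * cnj (u p) * cis (2 * pi * real m * (x p' - x p)))" for m
    proof -
      have "cis (2 * pi * real m * (x p' - x p)) = cis (2 * pi * real m * x p') * cnj (cis (2 * pi * real m * x p))"
        for p p' by (simp add: cis_cnj cis_mult right_diff_distrib)
      then show ?thesis
        unfolding complex_norm_square G_def cnj_sum sum_product by (simp only: complex_cnj_mult mult_ac)
    qed
    then have "complex_of_real (\<Sum>m\<in>{1..t}. (norm (G m))\<^sup>2) =
        (\<Sum>m\<in>{1..t}. \<Sum>p'\<in>P. \<Sum>p\<in>P. u p' * cnj (u p) * cis (2 * pi * real m * (x p' - x p)))"
      by simp
    also have "\<dots> = (\<Sum>p\<in>P. \<Sum>p'\<in>P. u p' * cnj (u p) * expsum (\<lambda>_. 1) t (x p' - x p))"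
      unfolding expsum_def sum_distrib_left
      by (subst sum.swap, subst (2) sum.swap, subst sum.swap) simp
    finally have "norm (complex_of_real (\<Sum>m\<in>{1..t}. (norm (G m))\<^sup>2)) =
        norm (\<Sum>p\<in>P. \<Sum>p'\<in>P. u p' * cnj (u p) * expsum (\<lambda>_. 1) t (x p' - x p))" by simp
    also have "\<dots> \<le> (\<Sum>p\<in>P. \<Sum>p'\<in>P. norm (u p' * cnj (u p) * expsum (\<lambda>_. 1) t (x p' - x p)))"
      by (rule order_trans[OF norm_sum sum_mono[OF norm_sum]])
    also have "\<dots> \<le> (\<Sum>p\<in>P. \<Sum>p'\<in>P. norm (expsum (\<lambda>_. 1) t (x p' - x p)))"
    proof (intro sum_mono)
      fix p p'
      have "norm (u p') * norm (u p) \<le> 1 * 1" by (intro mult_mono u1) auto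
      then show "norm (u p' * cnj (u p) * expsum (\<lambda>_. 1) t (x p' - x p)) \<le> norm (expsum (\<lambda>_. 1) t (x p' - x p))"
        by (simp add: norm_mult mult_left_le_one_le)
    qed
    finally show ?thesis by (simp add: sum_nonneg del: of_real_sum)
  qed
  finally have "Y\<^sup>2 \<le> real t * (\<Sum>p\<in>P. \<Sum>p'\<in>P. norm (expsum (\<lambda>_. 1) t (x p' - x p)))"
    by (simp add: mult_left_mono)
  then show ?thesis unfolding Y_def by (rule real_le_rsqrt)
qed

text \<open>Partial summation: the character of frequency \<open>\<beta>\<close> moves by at most
  \<open>2 * pi * \<bar>\<beta>\<bar>\<close> per step. All shorter sums enter, so later bounds must
  hold uniformly in the length.\<close>

lemma expsum_perturb:
  "norm (expsum \<alpha> T (\<theta> + \<beta>))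
    \<le> norm (expsum \<alpha> T \<theta>) + 2 * pi * \<bar>\<beta>\<bar> * (\<Sum>t<T. norm (expsum \<alpha> t \<theta>))"
proof -
  let ?e = "\<lambda>t. cis (2 * pi * real t * \<beta>)"
  have abel: "expsum \<alpha> T (\<theta> + \<beta>) = expsum \<alpha> T \<theta> * ?e T - (\<Sum>t<T. expsum \<alpha> t \<theta> * (?e (Suc t) - ?e t))"
  proof (induction T)
    case (Suc T)
    have "cis (2 * pi * real (Suc T) * (\<theta> + \<beta>)) = cis (2 * pi * real (Suc T) * \<theta>) * ?e (Suc T)"
      unfolding cis_mult distrib_left ..
    then have "expsum \<alpha> (Suc T) (\<theta> + \<beta>) = expsum \<alpha> T (\<theta> + \<beta>)
        + (expsum \<alpha> (Suc T) \<theta> - expsum \<alpha> T \<theta>) * ?e (Suc T)"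
      by (simp add: expsum_def algebra_simps)
    then show ?case unfolding Suc sum.lessThan_Suc by algebra
  qed (simp add: expsum_def)
  have "norm (expsum \<alpha> T (\<theta> + \<beta>))
      \<le> norm (expsum \<alpha> T \<theta> * ?e T) + norm (\<Sum>t<T. expsum \<alpha> t \<theta> * (?e (Suc t) - ?e t))"
    unfolding abel by (rule norm_triangle_ineq4)
  also have "norm (\<Sum>t<T. expsum \<alpha> t \<theta> * (?e (Suc t) - ?e t))
      \<le> (\<Sum>t<T. norm (expsum \<alpha> t \<theta>) * (2 * pi * \<bar>\<beta>\<bar>))"
  proof (rule order_trans[OF norm_sum sum_mono])
    fix t
    have "?e (Suc t) - ?e t = ?e t * (cis (2 * pi * \<beta>) - 1)"
      by (simp add: algebra_simps cis_mult)
    then have "norm (?e (Suc t) - ?e t) \<le> 2 * pi * \<bar>\<beta>\<bar>"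
      using norm_cis_minus_1_le[of "2 * pi * \<beta>"] by (simp add: norm_mult abs_mult)
    then show "norm (expsum \<alpha> t \<theta> * (?e (Suc t) - ?e t)) \<le> norm (expsum \<alpha> t \<theta>) * (2 * pi * \<bar>\<beta>\<bar>)"
      unfolding norm_mult by (intro mult_left_mono) auto
  qed
  finally show ?thesis by (simp add: norm_mult sum_distrib_left mult_ac)
qed

text \<open>After cancelling the common gcd \<open>g\<close>, the fractions have denominators
  \<open>r = m / g\<close> and \<open>r' = m' / g\<close>. Their difference modulo 1 is an integer
  over \<open>r * r'\<close>, and this integer is nonzero for distinct pairs.\<close>

lemma farey_spacing:
  fixes m m' h h' y y' k g :: int
  assumes g: "g = gcd h m" "g = gcd h' m'" and y: "coprime y m" "coprime y' m'"
    and h: "0 < h" "h < m" "0 < h'" "h' < m'"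
    and eq: "m = m' \<Longrightarrow> y = y'" and ne: "(m, h) \<noteq> (m', h')"
    and R: "of_int m \<le> R" "of_int m' \<le> (R::real)"
  shows "(of_int g)\<^sup>2 / R\<^sup>2 \<le> \<bar>of_int (h * y) / of_int m - of_int (h' * y') / of_int m' - of_int k\<bar>"
proof -
  have g0: "g > 0" using g h by simp
  obtain a r where a: "h = g * a" "m = g * r" "coprime a r"
    using g0 unfolding g(1) by (metis gcd_coprime_exists mult.commute less_irrefl)
  obtain a' r' where a': "h' = g * a'" "m' = g * r'" "coprime a' r'"
    using g0 unfolding g(2) by (metis gcd_coprime_exists mult.commute less_irrefl)
  have pos: "0 < a" "a < r" "0 < a'" "a' < r'"
    using h g0 by (auto simp: a a' zero_less_mult_iff)
  have cop: "coprime (a * y) r" "coprime (a' * y') r'"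
    using a(3) a'(3) y by (auto simp: a(2) a'(2))
  define z where "z = a * y * r' - a' * y' * r - k * r * r'"
  have "z \<noteq> 0"
  proof
    assume z0: "z = 0"
    then have e: "a * y * r' = r * (a' * y' + k * r')" by (simp add: z_def algebra_simps)
    then have "r dvd r' * (a * y)" by (metis dvd_triv_left mult.commute)
    then have "r dvd r'" using cop(1) by (metis coprime_commute coprime_dvd_mult_left_iff)
    moreover have "a' * y' * r = r' * (a * y - k * r)" using z0 by (simp add: z_def algebra_simps)
    then have "r' dvd r * (a' * y')" by (metis dvd_triv_left mult.commute)
    then have "r' dvd r" using cop(2) by (metis coprime_commute coprime_dvd_mult_left_iff)
    ultimately have rr: "r = r'" using pos by (intro zdvd_antisym_nonneg) auto
    \<comment> \<open>Equal reduced denominators give equal moduli because both pairs have the same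
      gcd; this is why points are compared only within one gcd class.\<close>
    then have mm: "m = m'" "y = y'" using a(2) a'(2) eq by auto
    have "r * (a * y) = r * (a' * y + k * r)" using e by (simp add: rr mm algebra_simps)
    then have "a * y = a' * y + k * r" using pos by simp
    then have "r dvd (a - a') * y" by (simp add: algebra_simps)
    moreover have "coprime r y" using y(1) by (simp add: a(2) coprime_commute)
    ultimately have "r dvd a - a'" by (metis coprime_dvd_mult_left_iff)
    \<comment> \<open>Both numerators lie strictly between 0 and \<open>r\<close>, so being
      congruent modulo \<open>r\<close> forces them to be equal.\<close>
    moreover have "\<bar>a - a'\<bar> < r" using pos rr by auto
    ultimately have "a = a'" using zdvd_imp_le[of r "\<bar>a - a'\<bar>"] by fastforce
    then show False using ne mm a a' by simp
  qed
  then have "1 \<le> \<bar>real_of_int z\<bar>" by linarith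
  have rpos: "0 < real_of_int r" "0 < real_of_int r'" using pos by linarith+
  have gpos: "0 < real_of_int g" using g0 by simp
  have "of_int (h * y) / of_int m - of_int (h' * y') / of_int m' - of_int k = of_int z / (of_int r * of_int r' :: real)"
    using rpos gpos by (simp add: a a' z_def field_simps)
  then have "\<bar>of_int (h * y) / of_int m - of_int (h' * y') / of_int m' - of_int k\<bar> = \<bar>real_of_int z\<bar> / (of_int r * of_int r')"
    using rpos by (simp add: abs_mult)
  also have "\<dots> \<ge> 1 / (of_int r * of_int r')"
    using rpos \<open>1 \<le> \<bar>real_of_int z\<bar>\<close> by (intro divide_right_mono) auto
  also have "1 / (of_int r * of_int r') = (of_int g)\<^sup>2 / (of_int m * of_int m' :: real)"
    using gpos by (simp add: a a' power2_eq_square)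
  also have "(of_int g)\<^sup>2 / (of_int m * of_int m' :: real) \<ge> (of_int g)\<^sup>2 / R\<^sup>2"
  proof (rule divide_left_mono)
    have mpos: "0 < real_of_int m" "0 < real_of_int m'" using h by linarith+
    show "of_int m * of_int m' \<le> R\<^sup>2"
      unfolding power2_eq_square using mpos R by (intro mult_mono) auto
    show "0 < R\<^sup>2 * (of_int m * of_int m')" using mpos R by auto
  qed simp
  finally show ?thesis .
qed

lemma sum_inverse_squares_le: "(\<Sum>g\<in>{1..n}. 1 / (real g)\<^sup>2) \<le> 2"
proof -
  \<comment> \<open>The subtracted term makes the induction work, since consecutive reciprocals
    differ by at least the next inverse square.\<close>
  have "(\<Sum>g\<in>{1..Suc n}. 1 / (real g)\<^sup>2) \<le> 2 - 1 / real (Suc n)" for n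
  proof (induction n)
    case (Suc n)
    have "1 / (real (Suc (Suc n)))\<^sup>2 \<le> 1 / real (Suc n) - 1 / real (Suc (Suc n))"
    proof -
      have "1 / (real (Suc (Suc n)))\<^sup>2 \<le> 1 / (real (Suc n) * real (Suc (Suc n)))"
        unfolding power2_eq_square by (intro divide_left_mono mult_right_mono) auto
      also have "\<dots> = 1 / real (Suc n) - 1 / real (Suc (Suc n))"
        by (simp add: field_simps)
      finally show ?thesis .
    qed
    then show ?case using Suc by simp
  qed simp
  from this[of "n - 1"] show ?thesis by (cases n) (auto intro: order_trans)
qed

text \<open>The large sieve for the points \<open>h * y m / m\<close>, split by
  \<open>g = gcd h m\<close>. Since \<open>h \<le> H < M1 \<le> m\<close>, every \<open>h\<close> is
  below its modulus, as the spacing argument requires.\<close>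

lemma sum_expsum_farey:
  fixes M :: "int set" and y :: "int \<Rightarrow> int" and M1 :: real
  assumes M1: "M1 \<ge> 1" and M: "finite M" "\<And>m. m \<in> M \<Longrightarrow> M1 \<le> of_int m \<and> of_int m < 2 * M1"
    and y: "\<And>m. m \<in> M \<Longrightarrow> coprime (y m) m" and H: "real H < M1"
    and n: "2 * M1\<^sup>2 \<le> real n" and \<alpha>: "\<And>m. norm (\<alpha> m) \<le> 1"
  shows "(\<Sum>m\<in>M. \<Sum>h\<in>{1..H}. norm (expsum \<alpha> t (real h * of_int (y m) / of_int m)))
    \<le> sqrt (real t * (real (card M) * real H * (2 * real t * real H + 16 * M1\<^sup>2 * harm n)))"
proof -
  define P where "P = M \<times> {1..H}"
  define x where "x p = real (snd p) * of_int (y (fst p)) / of_int (fst p)" for p :: "int \<times> nat"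
  have fin: "finite P" by (simp add: P_def M)
  have hm: "0 < h" "int h < m" if "(m, h) \<in> P" for m h
  proof -
    have "real h \<le> real H" using that by (simp add: P_def)
    then have "real h < of_int m" using that H M(2)[of m] by (auto simp: P_def)
    then show "int h < m" by linarith
    show "0 < h" using that by (simp add: P_def)
  qed
  define G where "G p = gcd (snd p) (nat (fst p))" for p :: "int \<times> nat"
  have GP: "G ` P \<subseteq> {1..H}"
  proof
    fix g assume "g \<in> G ` P"
    then obtain m h where mh: "(m, h) \<in> P" "g = gcd h (nat m)" by (auto simp: G_def)
    have "g \<le> h" unfolding mh(2) using hm[OF mh(1)] by (intro gcd_le1_nat) auto
    moreover have "g > 0" unfolding mh(2) using hm[OF mh(1)] by simp
    moreover have "h \<le> H" using mh by (simp add: P_def)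
    ultimately show "g \<in> {1..H}" by simp
  qed
  \<comment> \<open>Class \<open>g\<close> has spacing \<open>g\<^sup>2 / (2 * M1)\<^sup>2\<close>
    and contributes \<open>2 * t + 8 * M1\<^sup>2 / g\<^sup>2 * harm n\<close>. At most
    \<open>H\<close> classes occur, and the inverse squares sum to at most 2.\<close>
  have row: "(\<Sum>p'\<in>P. norm (expsum (\<lambda>_. 1) t (x p' - x p))) \<le> 2 * real t * real H + 16 * M1\<^sup>2 * harm n" for p
  proof -
    have h0: "harm n \<ge> (0::real)" by (rule harm_nonneg)
    have "(\<Sum>p'\<in>P. norm (expsum (\<lambda>_. 1) t (x p' - x p)))
        = (\<Sum>g\<in>{1..H}. \<Sum>p'\<in>{p'\<in>P. G p' = g}. norm (expsum (\<lambda>_. 1) t (x p' - x p)))"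
      using fin GP by (intro sum.group[symmetric]) auto
    also have "\<dots> \<le> (\<Sum>g\<in>{1..H}. 2 * real t + 2 / ((real g)\<^sup>2 / (2 * M1)\<^sup>2) * harm n)"
    proof (intro sum_mono sum_kernel_spaced)
      fix g assume g: "g \<in> {1..H}"
      have g1: "1 \<le> (real g)\<^sup>2" using g by (intro one_le_power; simp)
      show "0 < (real g)\<^sup>2 / (2 * M1)\<^sup>2" using g M1 by simp
      have "1 / (2 * ((real g)\<^sup>2 / (2 * M1)\<^sup>2)) = 2 * M1\<^sup>2 / (real g)\<^sup>2"
        by (simp add: field_simps power2_eq_square)
      \<comment> \<open>The case \<open>g = 1\<close> has the finest cells, so one \<open>n\<close>
        serves all classes.\<close>
      also have "\<dots> \<le> 2 * M1\<^sup>2 / 1" using g1 g by (intro divide_left_mono) auto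
      finally show "1 / (2 * ((real g)\<^sup>2 / (2 * M1)\<^sup>2)) \<le> real n" using n by simp
      fix p p' k assume p: "p \<in> {p' \<in> P. G p' = g}" "p' \<in> {p' \<in> P. G p' = g}" "p \<noteq> p'"
      obtain m h where mh: "p = (m, h)" by (cases p)
      obtain m' h' where mh': "p' = (m', h')" by (cases p')
      have m0: "m > 0" "m' > 0" using hm p mh mh' by fastforce+
      have gg: "int g = gcd (int h) m" "int g = gcd (int h') m'"
        using p m0 by (auto simp: mh mh' G_def gcd_int_def)
      have "(of_int (int g))\<^sup>2 / (2 * M1)\<^sup>2
          \<le> \<bar>of_int (int h * y m) / of_int m - of_int (int h' * y m') / of_int m' - of_int k\<bar>"
      proof (rule farey_spacing[OF gg])
        show "coprime (y m) m" "coprime (y m') m'"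
          using p y by (auto simp: mh mh' P_def)
        show "real_of_int m \<le> 2 * M1" "real_of_int m' \<le> 2 * M1"
          using p M(2) by (auto simp: mh mh' P_def intro: less_imp_le)
        show "0 < int h" "int h < m" "0 < int h'" "int h' < m'"
          using hm p by (auto simp: mh mh')
        show "(m, int h) \<noteq> (m', int h')" using p by (auto simp: mh mh')
      qed auto
      then show "(real g)\<^sup>2 / (2 * M1)\<^sup>2 \<le> \<bar>x p - x p' - of_int k\<bar>"
        by (simp add: x_def mh mh')
    qed (use fin in auto)
    also have "\<dots> = 2 * real t * real H + 8 * M1\<^sup>2 * harm n * (\<Sum>g\<in>{1..H}. 1 / (real g)\<^sup>2)"
      by (simp add: sum.distrib sum_distrib_left power_mult_distrib mult_ac)
    also have "\<dots> \<le> 2 * real t * real H + 8 * M1\<^sup>2 * harm n * 2"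
      using h0 by (intro add_left_mono mult_left_mono sum_inverse_squares_le) auto
    finally show ?thesis by simp
  qed
  have "(\<Sum>m\<in>M. \<Sum>h\<in>{1..H}. norm (expsum \<alpha> t (real h * of_int (y m) / of_int m)))
      = (\<Sum>p\<in>P. norm (expsum \<alpha> t (x p)))"
    by (simp add: P_def sum.cartesian_product x_def case_prod_beta)
  also have "\<dots> \<le> sqrt (real t * (\<Sum>p\<in>P. \<Sum>p'\<in>P. norm (expsum (\<lambda>_. 1) t (x p' - x p))))"
    by (rule sum_norm_expsum_le[OF fin \<alpha>])
  also have "\<dots> \<le> sqrt (real t * (\<Sum>p\<in>P. 2 * real t * real H + 16 * M1\<^sup>2 * harm n))"
    by (intro real_sqrt_le_mono mult_left_mono sum_mono row) auto
  also have "(\<Sum>p\<in>P. 2 * real t * real H + 16 * M1\<^sup>2 * harm n)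
      = real (card M) * real H * (2 * real t * real H + 16 * M1\<^sup>2 * harm n)"
    by (simp add: P_def card_cartesian_product)
  finally show ?thesis .
qed

section \<open>Sums over residue classes and lattices\<close>

lemma sum_roots_of_unity:
  fixes q :: nat and j :: int
  assumes "q > 0"
  shows "(\<Sum>h<q. cis (2 * pi * real h * (of_int j / real q))) = (if int q dvd j then of_nat q else 0)"
proof -
  define z where "z = cis (2 * pi * (of_int j / real q))"
  have pow: "cis (2 * pi * real h * (of_int j / real q)) = z ^ h" for h
    unfolding z_def by (simp only: Complex.DeMoivre mult_ac)
  have zq: "z ^ q = 1"
    using assms cis_multiple_2pi[of "of_int j"] pow[of q] by (simp add: mult.assoc)
  have "z = 1 \<longleftrightarrow> int q dvd j"
  proof
    assume "z = 1"
    then have "sin (pi * (of_int j / real q)) = 0"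
      using norm_cis_minus_1[of "2 * pi * (of_int j / real q)"] by (simp add: z_def)
    then obtain i :: int where "pi * (of_int j / real q) = of_int i * pi"
      unfolding sin_zero_iff_int2 by blast
    then have "pi * (of_int j / real q) = pi * of_int i" by (simp only: mult.commute)
    then have "of_int j / real q = of_int i" using mult_cancel_left pi_neq_zero by blast
    then have "real_of_int j = of_int (int q * i)" using assms by (simp add: field_simps)
    then have "j = int q * i" by (simp only: of_int_eq_iff)
    then show "int q dvd j" by simp
  next
    assume "int q dvd j"
    then obtain i where "j = int q * i" by blast
    then have "of_int j / real q = of_int i" using assms by simp
    then show "z = 1" unfolding z_def using cis_multiple_2pi[of "of_int i"] by simp
  qed
  moreover have "(\<Sum>h<q. z ^ h) = (if z = 1 then of_nat q else 0)"
    using zq by (simp add: geometric_sum)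
  ultimately show ?thesis by (simp only: pow)
qed

context derivative_tower
begin

definition residue_sum :: "real \<Rightarrow> nat \<Rightarrow> int \<Rightarrow> real" where
  "residue_sum N q a = (\<Sum>n\<in>{n\<in>{0..\<lfloor>N\<rfloor>}. int q dvd n - a}. w 0 (of_int n / N))"

text \<open>Writing \<open>n = q * k + r\<close> gives \<open>n / N = (k + r / q) / (N / q)\<close>,
  so the residue class becomes a shift by \<open>r / q\<close> at scale
  \<open>N / q\<close>.\<close>

lemma residue_sum_eq_shift_sum:
  assumes "q > 0" "N > 0"
  shows "residue_sum N q a = shift_sum 0 (N / real q) (of_int (a mod int q) / real q)"
proof -
  define r where "r = a mod int q"
  have r: "0 \<le> r" "r < int q" using assms by (auto simp: r_def)
  have dv: "int q dvd n - a \<longleftrightarrow> n mod int q = r" for n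
    by (simp add: r_def mod_eq_dvd_iff)
  have arg: "(of_int k + of_int r / real q) / (N / real q) = of_int (int q * k + r) / N" for k
    using assms by (simp add: field_simps)
  show ?thesis
    unfolding residue_sum_def shift_sum_def r_def[symmetric] arg dv
  \<comment> \<open>Only the window side has surplus indices: those with \<open>q * k + r\<close>
    outside \<open>{0..N}\<close>, where the weight vanishes.\<close>
  proof (rule sum.reindex_bij_witness_not_neutral[where S'="{}" and
        T'="{k \<in> window (N / real q). \<not> (0 \<le> int q * k + r \<and> int q * k + r \<le> \<lfloor>N\<rfloor>)}"
        and i="\<lambda>k. int q * k + r" and j="\<lambda>n. n div int q"])
    fix n assume "n \<in> {n \<in> {0..\<lfloor>N\<rfloor>}. n mod int q = r} - {}"
    then have n: "0 \<le> n" "n \<le> \<lfloor>N\<rfloor>" "n mod int q = r" by auto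
    show e: "int q * (n div int q) + r = n" using n(3) by (metis mult_div_mod_eq)
    have "of_int n \<le> N" using n(2) by linarith
    have "real q * of_int (n div int q) \<le> real_of_int n"
    proof -
      have "real_of_int n = real q * of_int (n div int q) + of_int r"
        using e by (metis of_int_add of_int_mult of_int_of_nat_eq)
      then show ?thesis using r by simp
    qed
    then have "of_int (n div int q) \<le> N / real q"
      using \<open>of_int n \<le> N\<close> assms by (simp add: field_simps)
    then have "n div int q \<le> \<lceil>N / real q\<rceil> + 1" by linarith
    moreover have "0 \<le> n div int q" using n assms by (simp add: pos_imp_zdiv_nonneg_iff)
    ultimately show "n div int q \<in> window (N / real q) -
        {k \<in> window (N / real q). \<not> (0 \<le> int q * k + r \<and> int q * k + r \<le> \<lfloor>N\<rfloor>)}"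
      using e n by (simp add: window_def)
  next
    fix k assume k: "k \<in> window (N / real q) -
        {k \<in> window (N / real q). \<not> (0 \<le> int q * k + r \<and> int q * k + r \<le> \<lfloor>N\<rfloor>)}"
    show "(int q * k + r) div int q = k" using r by simp
    show "int q * k + r \<in> {n \<in> {0..\<lfloor>N\<rfloor>}. n mod int q = r} - {}"
      using k r by simp
  next
    fix k assume k: "k \<in> {k \<in> window (N / real q). \<not> (0 \<le> int q * k + r \<and> int q * k + r \<le> \<lfloor>N\<rfloor>)}"
    then have "int q * k + r < 0 \<or> N < of_int (int q * k + r)" by (auto simp: le_floor_iff)
    then have "of_int (int q * k + r) / N \<notin> {0..1}"
    proof
      assume "int q * k + r < 0"
      then have "of_int (int q * k + r) < (0::real)" by (simp only: of_int_less_0_iff)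
      then have "of_int (int q * k + r) / N < 0" using assms by (intro divide_neg_pos)
      then show ?thesis by auto
    next
      assume "N < of_int (int q * k + r)"
      then have "1 < of_int (int q * k + r) / N" using assms by (simp only: less_divide_eq_1_pos)
      then show ?thesis by auto
    qed
    then show "w 0 (of_int (int q * k + r) / N) = 0" by (rule support)
  next
    fix n assume "n \<in> {n \<in> {0..\<lfloor>N\<rfloor>}. n mod int q = r}"
    then have "int q * (n div int q) + r = n" by (metis (mono_tags, lifting) mem_Collect_eq mult_div_mod_eq)
    then show "w 0 (of_int (int q * (n div int q) + r) / N) = w 0 (of_int n / N)" by simp
  qed auto
qed

lemma residue_sum_approx:
  assumes "q > 0" "N / real q \<ge> 1/2" "\<And>t. \<bar>w (Suc k) t\<bar> \<le> C"
  shows "\<bar>residue_sum N q a - N / real q * integral UNIV (w 0)\<bar> \<le> 11 * (N / real q) * C / (N / real q) ^ Suc k"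
proof -
  have "N / real q > 0" using assms(2) by linarith
  then have "N > 0" using assms(1) by (simp add: zero_less_divide_iff)
  moreover have "of_int (a mod int q) / real q \<in> {0..1}"
  proof -
    have "0 \<le> a mod int q" "a mod int q < int q" using assms(1) by auto
    then have "0 \<le> real_of_int (a mod int q)" "real_of_int (a mod int q) < real q" by linarith+
    then show ?thesis using assms(1) by simp
  qed
  ultimately show ?thesis
    unfolding residue_sum_eq_shift_sum[OF assms(1) \<open>N > 0\<close>]
    using assms by (intro shift_sum_approx) auto
qed

lemma twisted_sum_0_eq:
  assumes "N > 0"
  shows "twisted_sum 0 N \<theta> 0 = (\<Sum>n\<in>{0..\<lfloor>N\<rfloor>}. of_real (w 0 (of_int n / N)) * cis (- (2 * pi * \<theta> * of_int n)))"
  unfolding twisted_sum_def add_0_right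
proof (rule sum.mono_neutral_right)
  show "{0..\<lfloor>N\<rfloor>} \<subseteq> window N" unfolding window_def by (auto; linarith)
  show "\<forall>n\<in>window N - {0..\<lfloor>N\<rfloor>}. of_real (w 0 (of_int n / N)) * cis (- (2 * pi * \<theta> * of_int n)) = 0"
  proof
    fix n assume "n \<in> window N - {0..\<lfloor>N\<rfloor>}"
    then have "of_int n < (0::real) \<or> N < of_int n" by (auto simp: le_floor_iff)
    then have "of_int n / N \<notin> {0..1}" using assms by (auto simp: field_simps)
    then show "of_real (w 0 (of_int n / N)) * cis (- (2 * pi * \<theta> * of_int n)) = 0"
      using support by simp
  qed
qed simp

text \<open>The congruence is detected by averaging over the characters modulo \<open>q\<close>; the
  sum over \<open>n\<close> then becomes a twisted sum at scale \<open>N\<close> with frequency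
  \<open>h / q\<close>.\<close>

lemma residue_sum_fourier:
  assumes "q > 0" "N > 0"
  shows "complex_of_real (residue_sum N q a) =
    (\<Sum>h<q. cis (2 * pi * real h * (of_int a / real q)) * twisted_sum 0 N (real h / real q) 0) / of_nat q"
proof -
  let ?W = "\<lambda>n. complex_of_real (w 0 (of_int n / N))"
  have "(\<Sum>h<q. cis (2 * pi * real h * (of_int a / real q)) * twisted_sum 0 N (real h / real q) 0)
      = (\<Sum>h<q. \<Sum>n\<in>{0..\<lfloor>N\<rfloor>}. ?W n * cis (2 * pi * real h * (of_int (a - n) / real q)))"
    unfolding twisted_sum_0_eq[OF assms(2)] sum_distrib_left
  proof (intro sum.cong refl)
    fix h n
    have "cis (2 * pi * real h * (of_int (a - n) / real q)) =
        cis (2 * pi * real h * (of_int a / real q)) * cis (- (2 * pi * (real h / real q) * of_int n))"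
      by (simp add: cis_mult diff_divide_distrib right_diff_distrib)
    then show "cis (2 * pi * real h * (of_int a / real q)) * (?W n * cis (- (2 * pi * (real h / real q) * of_int n)))
        = ?W n * cis (2 * pi * real h * (of_int (a - n) / real q))"
      by (simp only: mult_ac)
  qed
  also have "\<dots> = (\<Sum>n\<in>{0..\<lfloor>N\<rfloor>}. ?W n * (\<Sum>h<q. cis (2 * pi * real h * (of_int (a - n) / real q))))"
    by (subst sum.swap) (simp add: sum_distrib_left)
  also have "\<dots> = (\<Sum>n\<in>{0..\<lfloor>N\<rfloor>}. if int q dvd n - a then ?W n * of_nat q else 0)"
    unfolding sum_roots_of_unity[OF assms(1)] by (intro sum.cong refl) (auto simp: dvd_diff_commute)
  also have "\<dots> = (\<Sum>n\<in>{n\<in>{0..\<lfloor>N\<rfloor>}. int q dvd n - a}. ?W n * of_nat q)"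
    by (rule sum.inter_filter[symmetric]) simp
  also have "\<dots> = complex_of_real (residue_sum N q a) * of_nat q"
    by (simp add: residue_sum_def sum_distrib_right)
  finally show ?thesis using assms(1) by simp
qed

text \<open>Support in the unit interval confines \<open>n\<close> to
  \<open>0 \<le> n \<le> N\<close>, so the infinite sum is finite and splits into one residue sum
  for each \<open>m\<close>.\<close>

lemma psi_eq_residue_sums:
  assumes N: "N > 0" and L: "\<And>m n. (m, n) \<in> L \<longleftrightarrow> int q dvd n - c * m"
  shows "psi (w 0) L N \<alpha> = (\<Sum>m\<in>{1..nat \<lfloor>N\<rfloor>}. \<alpha> m * of_real (residue_sum N q (c * int m)))"
proof -
  let ?f = "\<lambda>(m, n). \<alpha> (nat m) * complex_of_real (w 0 (of_int n / N))"
  let ?F = "SIGMA m:{1..\<lfloor>N\<rfloor>}. {n\<in>{0..\<lfloor>N\<rfloor>}. int q dvd n - c * m}"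
  have fin: "finite {n\<in>{0..\<lfloor>N\<rfloor>}. int q dvd n - c * m}" for m
    by (rule finite_subset[of _ "{0..\<lfloor>N\<rfloor>}"]) auto
  have "psi (w 0) L N \<alpha> = infsum ?f ?F"
    unfolding psi_def
  proof (rule infsum_cong_neutral)
    fix p assume "p \<in> ?F - {(m, n). (m, n) \<in> L \<and> 0 < m \<and> of_int m \<le> N}"
    then show "?f p = 0" by (auto simp: L le_floor_iff)
  next
    fix p assume p: "p \<in> {(m, n). (m, n) \<in> L \<and> 0 < m \<and> of_int m \<le> N} - ?F"
    obtain m n where mn: "p = (m, n)" by (cases p)
    have "of_int n < (0::real) \<or> N < of_int n" using p by (auto simp: mn L le_floor_iff)
    then have "of_int n / N \<notin> {0..1}" using N by (auto simp: field_simps)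
    then show "?f p = 0" using support by (simp add: mn)
  qed auto
  also have "\<dots> = sum ?f ?F" by (intro infsum_finite finite_SigmaI fin) simp
  also have "\<dots> = (\<Sum>m\<in>{1..\<lfloor>N\<rfloor>}. \<Sum>n\<in>{n\<in>{0..\<lfloor>N\<rfloor>}. int q dvd n - c * m}. \<alpha> (nat m) * complex_of_real (w 0 (of_int n / N)))"
    using fin by (intro sum.Sigma[symmetric]) simp_all
  also have "\<dots> = (\<Sum>m\<in>{1..\<lfloor>N\<rfloor>}. \<alpha> (nat m) * of_real (residue_sum N q (c * m)))"
    by (simp add: residue_sum_def sum_distrib_left)
  also have "\<dots> = (\<Sum>m\<in>{1..nat \<lfloor>N\<rfloor>}. \<alpha> m * of_real (residue_sum N q (c * int m)))"
    by (rule sum.reindex_bij_witness[of _ int nat]) auto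
  finally show ?thesis .
qed

end

section \<open>Lattices as congruence conditions, and reduced bases\<close>

lemma full_rank_lattice_residue_form:
  assumes "full_rank_lattice L" "Gcd (fst ` L) = 1"
  shows "lattice_det L > 0 \<and> (\<exists>c. \<forall>m n. (m, n) \<in> L \<longleftrightarrow> lattice_det L dvd n - c * m)"
proof -
  obtain u v where uv: "lattice_basis u v L" using assms(1) unfolding full_rank_lattice_def by blast
  obtain u1 u2 v1 v2 where u: "u = (u1, u2)" and v: "v = (v1, v2)" by (cases u, cases v)
  define d where "d = u1 * v2 - u2 * v1"
  have d0: "d \<noteq> 0" and L: "L = {(a * u1 + b * v1, a * u2 + b * v2) | a b. True}"
    using uv by (auto simp: lattice_basis_def det2_def u v d_def)
  have det: "lattice_det L = \<bar>d\<bar>" using lattice_det_eq[OF uv] by (simp add: det2_def u v d_def)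
  have "gcd u1 v1 dvd Gcd (fst ` L)" by (rule Gcd_greatest) (auto simp: L)
  then have "gcd u1 v1 = 1" using assms(2) by simp
  then obtain x y where xy: "x * u1 + y * v1 = 1" by (metis bezout_int)
  \<comment> \<open>By Bezout \<open>(1, c)\<close> is the lattice vector
    \<open>x * u + y * v\<close>; it exists because the first coordinates have gcd 1.\<close>
  define c where "c = x * u2 + y * v2"
  have "(m, n) \<in> L \<longleftrightarrow> d dvd n - c * m" for m n
  proof
    assume "(m, n) \<in> L"
    then obtain a b where ab: "m = a * u1 + b * v1" "n = a * u2 + b * v2" by (auto simp: L)
    have "n - c * m = n * (x * u1 + y * v1) - c * m" by (simp add: xy)
    also have "\<dots> = d * (x * b - y * a)" by (simp add: ab c_def d_def algebra_simps)
    finally show "d dvd n - c * m" by simp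
  next
    assume "d dvd n - c * m"
    then obtain t where t: "n = c * m + d * t" by (metis dvdE diff_eq_eq add.commute)
    \<comment> \<open>The vector \<open>(m, n)\<close> is \<open>m\<close> times
      \<open>(1, c)\<close> plus \<open>t\<close> times \<open>(0, d)\<close>, and
      \<open>(0, d)\<close> equals \<open>u1 * v - v1 * u\<close>.\<close>
    define a b where "a = m * x - t * v1" and "b = m * y + t * u1"
    have "a * u1 + b * v1 = m * (x * u1 + y * v1)" by (simp add: a_def b_def algebra_simps)
    then have "m = a * u1 + b * v1" by (simp add: xy)
    moreover have "n = a * u2 + b * v2" by (simp add: a_def b_def t c_def d_def algebra_simps)
    ultimately show "(m, n) \<in> L" by (auto simp: L)
  qed
  then show ?thesis using d0 by (auto simp: det)
qed

text \<open>Gauss reduction in the plane: minimality of the second vector bounds the inner product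
  by half the squared length of the first, and Lagrange's identity relates lengths, inner product
  and determinant.\<close>

lemma reduced_basis_norm_sq_le:
  assumes "reduced_basis L (m, b) b2" and L: "\<And>m n. (m, n) \<in> L \<longleftrightarrow> lattice_det L dvd n - c * m"
    and det: "lattice_det L > 0"
  shows "m\<^sup>2 + b\<^sup>2 \<le> 2 * lattice_det L"
proof -
  obtain m' b' where b2: "b2 = (m', b')" by (cases b2)
  let ?q = "lattice_det L"
  note R = assms(1)[unfolded reduced_basis_def b2]
  have q: "m * b' - b * m' = ?q" using R by (simp add: det2_def)
  have inL: "(m, b) \<in> L" "(m', b') \<in> L" using R by auto
  have len: "x\<^sup>2 + y\<^sup>2 \<le> z\<^sup>2 + t\<^sup>2" if "euclid_len (x, y) \<le> euclid_len (z, t)" for x y z t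
  proof -
    have "real_of_int (x\<^sup>2 + y\<^sup>2) \<le> real_of_int (z\<^sup>2 + t\<^sup>2)"
      using that by (simp add: euclid_len_def norm_Pair)
    then show ?thesis by (simp only: of_int_le_iff)
  qed
  \<comment> \<open>Adding multiples of the first vector leaves the second one outside those
    multiples, so minimality applies to all these translates.\<close>
  have nm: "(m' + k * m, b' + k * b) \<notin> int_multiples (m, b)" for k
  proof
    assume "(m' + k * m, b' + k * b) \<in> int_multiples (m, b)"
    then obtain j where j: "m' + k * m = j * m" "b' + k * b = j * b" by (auto simp: int_multiples_def)
    have "m' = (j - k) * m" "b' = (j - k) * b" using j by (auto simp: algebra_simps)
    then show False using q det by simp
  qed
  have inL2: "(m' + k * m, b' + k * b) \<in> L" for k
  proof -
    have "b' + k * b - c * (m' + k * m) = (b' - c * m') + k * (b - c * m)" by (simp add: algebra_simps)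
    then show ?thesis using inL unfolding L by (metis dvd_add dvd_mult)
  qed
  have red: "m'\<^sup>2 + b'\<^sup>2 \<le> (m' + k * m)\<^sup>2 + (b' + k * b)\<^sup>2" for k
    using R inL2[of k] nm[of k] by (intro len) blast
  define s where "s = m * m' + b * b'"
  define A where "A = m\<^sup>2 + b\<^sup>2"
  define B where "B = m'\<^sup>2 + b'\<^sup>2"
  have "2 * s \<le> A" using red[of "-1"] by (simp add: s_def A_def power2_eq_square algebra_simps)
  moreover have "- (2 * s) \<le> A" using red[of 1] by (simp add: s_def A_def power2_eq_square algebra_simps)
  ultimately have "\<bar>2 * s\<bar> \<le> \<bar>A\<bar>" by linarith
  then have s: "4 * s\<^sup>2 \<le> A\<^sup>2" unfolding abs_le_square_iff by (simp add: power_mult_distrib)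
  have "(m', b') \<noteq> (0, 0)" using q det by auto
  then have "A \<le> B" unfolding A_def B_def using R inL(2) by (intro len) blast
  moreover have A0: "A \<ge> 0" by (simp add: A_def)
  ultimately have "A\<^sup>2 \<le> A * B" by (simp add: power2_eq_square mult_left_mono)
  moreover have "A * B = ?q\<^sup>2 + s\<^sup>2"
    unfolding q[symmetric] A_def B_def s_def by algebra
  ultimately have "A\<^sup>2 \<le> ?q\<^sup>2 + s\<^sup>2" by metis
  \<comment> \<open>In fact \<open>3 * A\<^sup>2 \<le> 4 * ?q\<^sup>2\<close>; the weaker form has a
    rational square root.\<close>
  then have "A\<^sup>2 \<le> 4 * ?q\<^sup>2" using s zero_le_power2[of A] by linarith
  then have "A\<^sup>2 \<le> (2 * ?q)\<^sup>2" by (simp add: power_mult_distrib)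
  then have "A \<le> 2 * ?q" by (rule power2_le_imp_le) (use det in simp)
  then show ?thesis by (simp add: A_def)
qed

text \<open>If \<open>y\<close> and \<open>m\<close> had a common factor, dividing \<open>(m, b)\<close> by it would give a shorter lattice vector.\<close>

lemma reduced_basis_slope:
  assumes "reduced_basis L (m, b) b2" and L: "\<And>m n. (m, n) \<in> L \<longleftrightarrow> lattice_det L dvd n - c * m"
    and m: "m > 0"
  shows "\<exists>y. coprime y m \<and> c * m = y * lattice_det L + b"
proof -
  let ?q = "lattice_det L"
  note R = assms(1)[unfolded reduced_basis_def]
  have "?q dvd b - c * m" using R L by auto
  then obtain y' where y': "b - c * m = ?q * y'" by blast
  define y where "y = - y'"
  have y: "c * m = y * ?q + b" using y' by (simp add: y_def algebra_simps)
  define g where "g = gcd y m"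
  have g0: "g > 0" using m by (simp add: g_def)
  obtain y1 m1 where g: "y = g * y1" "m = g * m1" unfolding g_def by (meson dvdE gcd_dvd1 gcd_dvd2)
  define b1 where "b1 = c * m1 - y1 * ?q"
  have b: "b = g * b1" using y by (simp add: g b1_def algebra_simps)
  have "m1 > 0" using m g g0 by (simp add: zero_less_mult_iff)
  moreover have "(m1, b1) \<in> L" unfolding L b1_def by simp
  ultimately have "euclid_len (m, b) \<le> euclid_len (m1, b1)" using R by auto
  then have "real_of_int (m\<^sup>2 + b\<^sup>2) \<le> real_of_int (m1\<^sup>2 + b1\<^sup>2)"
    by (simp add: euclid_len_def norm_Pair)
  then have "g\<^sup>2 * (m1\<^sup>2 + b1\<^sup>2) \<le> 1 * (m1\<^sup>2 + b1\<^sup>2)"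
    by (simp only: of_int_le_iff) (simp add: g b power_mult_distrib algebra_simps)
  moreover have "m1\<^sup>2 + b1\<^sup>2 > 0" using \<open>m1 > 0\<close> by (simp add: add_pos_nonneg)
  ultimately have "g\<^sup>2 \<le> 1" by (simp only: mult_le_cancel_right_pos)
  then have "g = 1" using g0 by (simp add: abs_square_le_1)
  then show ?thesis using y by (auto simp: g_def coprime_iff_gcd_eq_1)
qed

section \<open>Error bounds for a single lattice\<close>

context derivative_tower
begin

text \<open>No cancellation between different \<open>m\<close> is used: each residue sum is already
  close to its mean.\<close>

lemma psi_error_le_of_small_det:
  assumes "q > 0" "N / real q \<ge> 1/2" and L: "\<And>m n. (m, n) \<in> L \<longleftrightarrow> int q dvd n - c * m"
    and \<alpha>: "\<And>m. norm (\<alpha> m) \<le> 1" and C: "\<And>t. \<bar>w (Suc k) t\<bar> \<le> C"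
  shows "norm (psi (w 0) L N \<alpha> - of_real (N * integral UNIV (w 0) / real q) * (\<Sum>m\<in>{1..nat \<lfloor>N\<rfloor>}. \<alpha> m))
    \<le> N * (11 * C / (N / real q) ^ k)"
proof -
  have X: "N / real q > 0" using assms(2) by linarith
  then have N: "N > 0" using assms(1) by (simp add: zero_less_divide_iff)
  have C0: "C \<ge> 0" using C[of 0] by linarith
  let ?E = "11 * C / (N / real q) ^ k"
  have "norm (psi (w 0) L N \<alpha> - of_real (N * integral UNIV (w 0) / real q) * (\<Sum>m\<in>{1..nat \<lfloor>N\<rfloor>}. \<alpha> m))
      = norm (\<Sum>m\<in>{1..nat \<lfloor>N\<rfloor>}. \<alpha> m * of_real (residue_sum N q (c * int m) - N / real q * integral UNIV (w 0)))"
    unfolding psi_eq_residue_sums[OF N L]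
    by (simp add: sum_distrib_left sum_subtractf sum_divide_distrib algebra_simps)
  also have "\<dots> \<le> (\<Sum>m\<in>{1..nat \<lfloor>N\<rfloor>}. 1 * ?E)"
  proof (rule order_trans[OF norm_sum sum_mono])
    fix m
    have "\<bar>residue_sum N q (c * int m) - N / real q * integral UNIV (w 0)\<bar>
        \<le> 11 * (N / real q) * C / (N / real q) ^ Suc k"
      by (rule residue_sum_approx[OF assms(1,2) C])
    also have "\<dots> = ?E"
    proof -
      have "11 * X * C / X ^ Suc k = 11 * C / X ^ k" if "X > 0" for X :: real
        using that by simp
      from this[OF X] show ?thesis .
    qed
    finally have "norm (complex_of_real (residue_sum N q (c * int m) - N / real q * integral UNIV (w 0))) \<le> ?E"
      unfolding norm_of_real by simp
    then show "norm (\<alpha> m * of_real (residue_sum N q (c * int m) - N / real q * integral UNIV (w 0))) \<le> 1 * ?E"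
      unfolding norm_mult by (intro mult_mono \<alpha>) auto
  qed
  also have "\<dots> \<le> N * ?E"
  proof -
    have "real (nat \<lfloor>N\<rfloor>) \<le> N" using N by simp
    moreover have "0 \<le> ?E" using X C0 by (intro divide_nonneg_nonneg) auto
    ultimately have "real (nat \<lfloor>N\<rfloor>) * ?E \<le> N * ?E" by (rule mult_right_mono)
    then show ?thesis by (simp only: sum_constant card_atLeastAtMost mult_1) simp
  qed
  finally show ?thesis .
qed

text \<open>The frequency \<open>h / q\<close> is farther than \<open>H / q\<close> from every
  integer, so the chord bound feeds \<open>k\<close> rounds of decay with gain \<open>\<rho>\<close>
  each.\<close>

lemma twisted_sum_tail:
  assumes N: "N \<ge> 1" and h: "h \<in> {1..<q}" "H < real h" "H < real (q - h)"
    and \<rho>: "0 < \<rho>" "\<rho> \<le> 2 * N * H / real q" and C: "\<And>t. \<bar>w k t\<bar> \<le> C"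
  shows "norm (twisted_sum 0 N (real h / real q) 0) \<le> 11 * N * C / \<rho> ^ k"
proof -
  have q: "real q > 0" using h by auto
  have hq: "real (q - h) = real q - real h" using h by auto
  let ?d = "norm (cis (2 * pi * (real h / real q)) - 1)"
  have "2 * (H / real q) \<le> ?d"
  proof (cases "2 * h \<le> q")
    case True
    then have "real (2 * h) \<le> real q" by (simp only: of_nat_le_iff)
    then have "\<bar>real h / real q\<bar> \<le> 1/2" using q by (simp add: field_simps)
    from norm_cis_minus_1_ge[OF this] have "2 * (real h / real q) \<le> ?d" by simp
    moreover have "2 * (H / real q) \<le> 2 * (real h / real q)"
      using h q by (simp add: divide_right_mono)
    ultimately show ?thesis by linarith
  next
    case False
    \<comment> \<open>Past one half the nearest integer is 1, so \<open>h / q - 1\<close> takes the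
      place of \<open>h / q\<close>.\<close>
    then have "real q \<le> real (2 * h)" by (simp only: of_nat_le_iff)
    moreover have "real h < real q" using h by simp
    ultimately have ab: "\<bar>real h / real q - 1\<bar> \<le> 1/2" "\<bar>real h / real q - 1\<bar> = real (q - h) / real q"
      using q by (auto simp: hq field_simps abs_if)
    have "cis (2 * pi * (real h / real q - 1)) = cis (2 * pi * (real h / real q))"
      by (simp add: right_diff_distrib flip: cis_divide)
    then have "2 * (real (q - h) / real q) \<le> ?d"
      using norm_cis_minus_1_ge[OF ab(1)] ab(2) by simp
    moreover have "2 * (H / real q) \<le> 2 * (real (q - h) / real q)"
      using h q by (simp add: divide_right_mono)
    ultimately show ?thesis by linarith
  qed
  then have "N * (2 * (H / real q)) \<le> N * ?d" using N by (intro mult_left_mono) auto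
  then have "\<rho> \<le> N * ?d" using \<rho>(2) by (simp add: mult_ac)
  then have "\<rho> ^ k \<le> (N * ?d) ^ k" using \<rho>(1) by (intro power_mono) auto
  then have "norm (twisted_sum 0 N (real h / real q) 0) * \<rho> ^ k
      \<le> norm (twisted_sum 0 N (real h / real q) 0) * (N * ?d) ^ k"
    by (intro mult_left_mono) auto
  also have "\<dots> \<le> 11 * N * C" using N C by (intro twisted_sum_decay) auto
  finally show ?thesis using \<rho>(1) by (simp add: pos_le_divide_eq)
qed

text \<open>Frequency 0 yields the main term up to a bounded factor error, frequencies within
  \<open>H\<close> of 0 modulo \<open>q\<close> yield exponential sums, and the remaining ones are
  negligible.\<close>

lemma psi_error_le_expsums:
  assumes N: "N \<ge> 1" and q: "q > 0" and L: "\<And>m n. (m, n) \<in> L \<longleftrightarrow> int q dvd n - c * m"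
    and \<alpha>: "\<And>m. norm (\<alpha> m) \<le> 1"
    and \<rho>: "0 < \<rho>" "\<rho> \<le> 2 * N * H / real q"
    and C0: "\<And>t. \<bar>w 0 t\<bar> \<le> C0" and C1: "\<And>t. \<bar>w 1 t\<bar> \<le> C1" and Ck: "\<And>t. \<bar>w k t\<bar> \<le> Ck"
  defines "T \<equiv> nat \<lfloor>N\<rfloor>" and "\<theta> \<equiv> of_int c / real q"
  shows "norm (psi (w 0) L N \<alpha> - of_real (N * integral UNIV (w 0) / real q) * (\<Sum>m\<in>{1..T}. \<alpha> m))
    \<le> (11 * C1 * N + 11 * N * C0 *
        ((\<Sum>h\<in>{1..nat \<lfloor>H\<rfloor>}. norm (expsum \<alpha> T (real h * \<theta>)))
         + (\<Sum>h\<in>{1..nat \<lfloor>H\<rfloor>}. norm (expsum \<alpha> T (- (real h * \<theta>)))))) / real q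
      + 11 * N\<^sup>2 * Ck / \<rho> ^ k"
proof -
  define S where "S h = twisted_sum 0 N (real h / real q) 0" for h
  define A where "A h = expsum \<alpha> T (real h * \<theta>)" for h
  define F where "F = (\<Sum>h\<in>{1..<q}. A h * S h)"
  define Hn where "Hn = nat \<lfloor>H\<rfloor>"
  define B where "B = 11 * N * C0"
  define E where "E = 11 * N\<^sup>2 * Ck / \<rho> ^ k"
  have N0: "N > 0" using N by simp
  have TN: "real T \<le> N" using N by (simp add: T_def)
  have q0: "real q > 0" using q by simp
  have pos: "C0 \<ge> 0" "C1 \<ge> 0" "Ck \<ge> 0" using C0[of 0] C1[of 0] Ck[of 0] by linarith+
  have B0: "B \<ge> 0" using pos N0 by (simp add: B_def)
  have E0: "E \<ge> 0" using pos N0 \<rho> by (simp add: E_def)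
  have "psi (w 0) L N \<alpha> = (\<Sum>m\<in>{1..T}. \<Sum>h<q. \<alpha> m * (cis (2 * pi * real m * (real h * \<theta>)) * S h) / of_nat q)"
    unfolding psi_eq_residue_sums[OF N0 L] residue_sum_fourier[OF q N0] T_def
    by (intro sum.cong refl) (simp add: sum_distrib_left sum_divide_distrib S_def \<theta>_def mult_ac)
  also have "\<dots> = (\<Sum>h<q. A h * S h) / of_nat q"
    by (subst sum.swap) (simp add: A_def expsum_def sum_distrib_left sum_distrib_right sum_divide_distrib mult_ac)
  also have "{..<q} = insert 0 {1..<q}" using q by auto
  finally have psi: "psi (w 0) L N \<alpha> = (A 0 * S 0 + F) / of_nat q" by (simp add: F_def)
  have A0: "A 0 = (\<Sum>m\<in>{1..T}. \<alpha> m)" by (simp add: A_def expsum_def)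
  have S0: "S 0 = of_real (shift_sum 0 N 0)" by (simp add: S_def twisted_sum_def shift_sum_def)
  have "psi (w 0) L N \<alpha> - of_real (N * integral UNIV (w 0) / real q) * (\<Sum>m\<in>{1..T}. \<alpha> m)
      = (A 0 * of_real (shift_sum 0 N 0 - N * integral UNIV (w 0)) + F) / of_nat q"
    unfolding psi S0 A0[symmetric] using q by (simp add: field_simps)
  also have "norm \<dots> \<le> (norm (A 0 * of_real (shift_sum 0 N 0 - N * integral UNIV (w 0))) + norm F) / real q"
    by (simp add: norm_divide divide_right_mono norm_triangle_ineq)
  also have "\<dots> \<le> (11 * C1 * N + (B * ((\<Sum>h\<in>{1..Hn}. norm (A h)) + (\<Sum>h\<in>{1..Hn}. norm (expsum \<alpha> T (- (real h * \<theta>))))) + real q * E)) / real q"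
  proof (intro divide_right_mono add_mono)
    have "\<bar>shift_sum 0 N 0 - N * integral UNIV (w 0)\<bar> \<le> 11 * N * C1 / N ^ Suc 0"
      using N C1 by (intro shift_sum_approx) auto
    then have "\<bar>shift_sum 0 N 0 - N * integral UNIV (w 0)\<bar> \<le> 11 * C1" using N0 by simp
    moreover have "norm (A 0) \<le> N" using norm_expsum_le[where \<alpha>=\<alpha> and t=T, OF \<alpha>] TN unfolding A_def by (meson order_trans)
    ultimately have "norm (A 0) * \<bar>shift_sum 0 N 0 - N * integral UNIV (w 0)\<bar> \<le> N * (11 * C1)"
      using N0 by (intro mult_mono) auto
    then show "norm (A 0 * of_real (shift_sum 0 N 0 - N * integral UNIV (w 0))) \<le> 11 * C1 * N"
      unfolding norm_mult norm_of_real by (simp add: mult_ac)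
  next
    let ?a = "\<lambda>h. B * norm (A h)" and ?b = "\<lambda>h. B * norm (expsum \<alpha> T (- (real h * \<theta>)))"
    \<comment> \<open>The cutoff \<open>Hn\<close> may exceed \<open>q - 1\<close>, so the truncated
      sum is only enlarged to the full range.\<close>
    have restrict: "(\<Sum>h\<in>{1..<q}. if h \<le> Hn then f h else 0) \<le> (\<Sum>h\<in>{1..Hn}. f h)"
      if "\<And>h. f h \<ge> 0" for f :: "nat \<Rightarrow> real"
    proof -
      have "(\<Sum>h\<in>{1..<q}. if h \<le> Hn then f h else 0) = (\<Sum>h\<in>{h\<in>{1..<q}. h \<le> Hn}. f h)"
        by (rule sum.inter_filter[symmetric]) simp
      also have "\<dots> \<le> (\<Sum>h\<in>{1..Hn}. f h)" using that by (intro sum_mono2) auto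
      finally show ?thesis .
    qed
    \<comment> \<open>The low ranges at both ends may overlap, so all three nonnegative bounds are
      added instead of splitting into disjoint cases.\<close>
    have "norm F \<le> (\<Sum>h\<in>{1..<q}. (if h \<le> Hn then ?a h else 0) + (if q - h \<le> Hn then ?b (q - h) else 0) + E)"
      unfolding F_def
    proof (rule order_trans[OF norm_sum sum_mono])
      fix h assume h: "h \<in> {1..<q}"
      have SB: "norm (S h) \<le> B" unfolding S_def B_def using N C0 by (intro twisted_sum_bound) auto
      have n1: "norm (A h * S h) \<le> ?a h"
        unfolding norm_mult using mult_left_mono[OF SB norm_ge_zero[of "A h"]] by (simp add: mult_ac)
      have "real (q - h) = real q - real h" using h by auto
      \<comment> \<open>As \<open>q * \<theta> = c\<close> is an integer, frequency \<open>h\<close>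
        equals \<open>-(q - h)\<close> modulo 1.\<close>
      then have "- (real (q - h) * \<theta>) = real h * \<theta> + of_int (- c)"
        using q by (simp add: \<theta>_def field_simps)
      then have n2: "norm (A h * S h) \<le> ?b (q - h)"
        using n1 expsum_add_int[of \<alpha> T "real h * \<theta>" "- c"] by (simp add: A_def)
      have n3: "norm (A h * S h) \<le> E" if "\<not> h \<le> Hn" "\<not> q - h \<le> Hn"
      proof -
        have "H < real h" "H < real (q - h)" using that unfolding Hn_def by linarith+
        then have "norm (S h) \<le> 11 * N * Ck / \<rho> ^ k"
          unfolding S_def using N h \<rho> Ck by (intro twisted_sum_tail) auto
        moreover have "norm (A h) \<le> N"
          using norm_expsum_le[where \<alpha>=\<alpha> and t=T, OF \<alpha>] TN unfolding A_def by (meson order_trans)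
        ultimately have "norm (A h) * norm (S h) \<le> N * (11 * N * Ck / \<rho> ^ k)"
          using N0 by (intro mult_mono) auto
        then show ?thesis by (simp add: norm_mult E_def power2_eq_square mult_ac)
      qed
      have nn: "?a h \<ge> 0" "?b (q - h) \<ge> 0" using B0 by auto
      show "norm (A h * S h) \<le> (if h \<le> Hn then ?a h else 0) + (if q - h \<le> Hn then ?b (q - h) else 0) + E"
        by (cases "h \<le> Hn"; cases "q - h \<le> Hn";
            use n1 n2 n3 nn E0 in \<open>simp only: if_True if_False simp_thms; linarith\<close>)
    qed
    also have "\<dots> = (\<Sum>h\<in>{1..<q}. if h \<le> Hn then ?a h else 0)
        + (\<Sum>h\<in>{1..<q}. if q - h \<le> Hn then ?b (q - h) else 0) + real (q - 1) * E"
      by (simp add: sum.distrib)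
    also have "(\<Sum>h\<in>{1..<q}. if q - h \<le> Hn then ?b (q - h) else 0) = (\<Sum>h\<in>{1..<q}. if h \<le> Hn then ?b h else 0)"
      by (rule sum.reindex_bij_witness[of _ "\<lambda>h. q - h" "\<lambda>h. q - h"]) auto
    also have "(\<Sum>h\<in>{1..<q}. if h \<le> Hn then ?a h else 0) + (\<Sum>h\<in>{1..<q}. if h \<le> Hn then ?b h else 0) + real (q - 1) * E
        \<le> (\<Sum>h\<in>{1..Hn}. ?a h) + (\<Sum>h\<in>{1..Hn}. ?b h) + real q * E"
      using B0 E0 by (intro add_mono restrict mult_right_mono) auto
    finally show "norm F \<le> B * ((\<Sum>h\<in>{1..Hn}. norm (A h)) + (\<Sum>h\<in>{1..Hn}. norm (expsum \<alpha> T (- (real h * \<theta>))))) + real q * E"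
      by (simp add: sum_distrib_left distrib_left)
  qed (use q in simp)
  also have "\<dots> = (11 * C1 * N + B * ((\<Sum>h\<in>{1..Hn}. norm (A h)) + (\<Sum>h\<in>{1..Hn}. norm (expsum \<alpha> T (- (real h * \<theta>)))))) / real q + E"
    using q0 by (simp add: add_divide_distrib)
  finally show ?thesis by (simp only: A_def B_def E_def Hn_def)
qed

end

section \<open>Admissible families\<close>

lemma admissible_family_residue_forms:
  assumes "admissible_family D M1 \<Lambda> B1 B2"
  shows "\<exists>c. \<forall>L\<in>\<Lambda>. lattice_det L > 0 \<and> (\<forall>m n. (m, n) \<in> L \<longleftrightarrow> lattice_det L dvd n - c L * m)"
proof -
  have "\<forall>L\<in>\<Lambda>. \<exists>c. lattice_det L > 0 \<and> (\<forall>m n. (m, n) \<in> L \<longleftrightarrow> lattice_det L dvd n - c * m)"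
  proof
    fix L assume "L \<in> \<Lambda>"
    then have "full_rank_lattice L" "Gcd (fst ` L) = 1"
      using assms by (auto simp: admissible_family_def)
    then show "\<exists>c. lattice_det L > 0 \<and> (\<forall>m n. (m, n) \<in> L \<longleftrightarrow> lattice_det L dvd n - c * m)"
      using full_rank_lattice_residue_form by simp
  qed
  then show ?thesis by (rule bchoice)
qed

lemma admissible_family_inj:
  assumes "admissible_family D M1 \<Lambda> B1 B2"
  shows "inj_on (\<lambda>L. fst (B1 L)) \<Lambda>"
  using assms unfolding admissible_family_def inj_on_def by metis

text \<open>Distinct lattices have distinct first coordinates in an interval of length
  \<open>M1\<close>, which holds at most \<open>M1 + 1 \<le> 2 * M1\<close> integers.\<close>

lemma admissible_family_card:
  assumes adm: "admissible_family D M1 \<Lambda> B1 B2" and M1: "M1 \<ge> 1"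
  shows "real (card \<Lambda>) \<le> 2 * M1"
proof -
  have "card \<Lambda> = card ((\<lambda>L. fst (B1 L)) ` \<Lambda>)"
    using admissible_family_inj[OF adm] by (simp add: card_image)
  also have "\<dots> \<le> card {\<lceil>M1\<rceil>..\<lceil>2 * M1\<rceil> - 1}"
  proof (rule card_mono)
    show "(\<lambda>L. fst (B1 L)) ` \<Lambda> \<subseteq> {\<lceil>M1\<rceil>..\<lceil>2 * M1\<rceil> - 1}"
    proof
      fix m assume "m \<in> (\<lambda>L. fst (B1 L)) ` \<Lambda>"
      then have "M1 \<le> of_int m" "of_int m < 2 * M1" using adm by (auto simp: admissible_family_def)
      then show "m \<in> {\<lceil>M1\<rceil>..\<lceil>2 * M1\<rceil> - 1}" by (simp, linarith)
    qed
  qed simp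
  also have "\<dots> = nat (\<lceil>2 * M1\<rceil> - \<lceil>M1\<rceil>)" by simp
  finally have "real (card \<Lambda>) \<le> real (nat (\<lceil>2 * M1\<rceil> - \<lceil>M1\<rceil>))" by simp
  also have "\<dots> = of_int (\<lceil>2 * M1\<rceil> - \<lceil>M1\<rceil>)" using M1 by (simp add: ceiling_mono)
  also have "\<dots> \<le> 2 * M1" using M1 by linarith
  finally show ?thesis .
qed

text \<open>The first coordinate is at most the shortest length, whose square is at most twice the
  determinant. A lattice must exist for this, so the final bounds treat the empty family
  separately.\<close>

lemma admissible_family_M1_sq_le:
  assumes adm: "admissible_family D M1 \<Lambda> B1 B2" and M1: "M1 \<ge> 1" and L: "L \<in> \<Lambda>"
  shows "M1\<^sup>2 \<le> 4 * D"
proof -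
  obtain c where c: "\<forall>L\<in>\<Lambda>. lattice_det L > 0 \<and> (\<forall>m n. (m, n) \<in> L \<longleftrightarrow> lattice_det L dvd n - c L * m)"
    using admissible_family_residue_forms[OF adm] by blast
  obtain m b where mb: "B1 L = (m, b)" by (cases "B1 L")
  have "m\<^sup>2 + b\<^sup>2 \<le> 2 * lattice_det L"
  proof (rule reduced_basis_norm_sq_le)
    show "reduced_basis L (m, b) (B2 L)" using adm L mb by (auto simp: admissible_family_def)
  qed (use c L in auto)
  then have "m\<^sup>2 \<le> 2 * lattice_det L" by (smt (verit) zero_le_power2)
  then have "real_of_int (m\<^sup>2) \<le> real_of_int (2 * lattice_det L)" by (simp only: of_int_le_iff)
  moreover have "M1\<^sup>2 \<le> (real_of_int m)\<^sup>2"
    using adm L mb M1 by (intro power_mono) (auto simp: admissible_family_def)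
  moreover have "real_of_int (lattice_det L) < 2 * D" using adm L by (auto simp: admissible_family_def)
  ultimately show ?thesis by simp
qed

text \<open>Write \<open>c / q = y / m + b / (q * m)\<close>. The large sieve handles the points
  \<open>h * y / m\<close>, and partial summation removes the small second term.\<close>

lemma admissible_family_sum_expsum_le:
  assumes adm: "admissible_family D M1 \<Lambda> B1 B2" and D: "1 \<le> D" and M1: "1 \<le> M1"
    and c: "\<And>L m n. L \<in> \<Lambda> \<Longrightarrow> (m, n) \<in> L \<longleftrightarrow> lattice_det L dvd n - c L * m"
    and pos: "\<And>L. L \<in> \<Lambda> \<Longrightarrow> lattice_det L > 0"
    and H: "0 \<le> H" "H < M1" and n: "2 * M1\<^sup>2 \<le> real n" and \<alpha>: "\<And>m. norm (\<alpha> m) \<le> 1"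
  shows "(\<Sum>L\<in>\<Lambda>. \<Sum>h\<in>{1..nat \<lfloor>H\<rfloor>}. norm (expsum \<alpha> T (real h * (of_int (c L) / of_int (lattice_det L)))))
    \<le> (1 + 2 * pi * (2 * H / (sqrt D * M1)) * real T)
      * sqrt (real T * (real (card \<Lambda>) * H * (2 * real T * H + 16 * M1\<^sup>2 * harm n)))"
proof -
  define m where "m L = fst (B1 L)" for L
  define b where "b L = snd (B1 L)" for L
  define \<beta> where "\<beta> = 2 * H / (sqrt D * M1)"
  define I where "I = {1..nat \<lfloor>H\<rfloor>}"
  define Z where "Z = sqrt (real T * (real (card \<Lambda>) * H * (2 * real T * H + 16 * M1\<^sup>2 * harm n)))"
  have m: "M1 \<le> of_int (m L)" "of_int (m L) < 2 * M1" if "L \<in> \<Lambda>" for L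
    using adm that by (auto simp: admissible_family_def m_def)
  have red: "reduced_basis L (m L, b L) (B2 L)" if "L \<in> \<Lambda>" for L
    using adm that by (auto simp: admissible_family_def m_def b_def)
  have m0: "m L > 0" if "L \<in> \<Lambda>" for L
    using m(1)[OF that] M1 by linarith
  have "\<forall>L\<in>\<Lambda>. \<exists>y. coprime y (m L) \<and> c L * m L = y * lattice_det L + b L"
    using reduced_basis_slope[OF red c m0] by blast
  then obtain y where y: "\<And>L. L \<in> \<Lambda> \<Longrightarrow> coprime (y L) (m L)"
      "\<And>L. L \<in> \<Lambda> \<Longrightarrow> c L * m L = y L * lattice_det L + b L"
    by metis
  have fin: "finite \<Lambda>" by (rule admissible_family_finite[OF adm])
  have inj: "inj_on m \<Lambda>" unfolding m_def by (rule admissible_family_inj[OF adm])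
  define f where "f t L h = norm (expsum \<alpha> t (real h * of_int (y L) / of_int (m L)))" for t L h
  have Hn: "real (nat \<lfloor>H\<rfloor>) \<le> H" using H by simp
  have h0: "harm n \<ge> (0::real)" by (rule harm_nonneg)
  \<comment> \<open>Uniformity in \<open>t \<le> T\<close> serves the shorter sums created by
    partial summation.\<close>
  have Y: "(\<Sum>L\<in>\<Lambda>. \<Sum>h\<in>I. f t L h) \<le> Z" if "t \<le> T" for t
  proof -
    \<comment> \<open>The sieve is indexed by moduli; injectivity of \<open>m\<close> lets
      \<open>y\<close> be read as a function of the modulus.\<close>
    define y' where "y' k = y (inv_into \<Lambda> m k)" for k
    have y': "y' (m L) = y L" if "L \<in> \<Lambda>" for L using that inj by (simp add: y'_def)
    have "(\<Sum>L\<in>\<Lambda>. \<Sum>h\<in>I. f t L h) = (\<Sum>k\<in>m ` \<Lambda>. \<Sum>h\<in>I. norm (expsum \<alpha> t (real h * of_int (y' k) / of_int k)))"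
      unfolding sum.reindex[OF inj] o_def f_def by (intro sum.cong refl) (simp add: y')
    also have "\<dots> \<le> sqrt (real t * (real (card (m ` \<Lambda>)) * real (nat \<lfloor>H\<rfloor>) * (2 * real t * real (nat \<lfloor>H\<rfloor>) + 16 * M1\<^sup>2 * harm n)))"
      unfolding I_def
    proof (rule sum_expsum_farey)
      show "real (nat \<lfloor>H\<rfloor>) < M1" using Hn H by linarith
      show "coprime (y' k) k" if "k \<in> m ` \<Lambda>" for k using that y y' by auto
    qed (use M1 fin m n \<alpha> in auto)
    also have "\<dots> \<le> Z"
      unfolding Z_def card_image[OF inj] using that Hn H h0
      by (intro real_sqrt_le_mono mult_mono add_mono mult_left_mono) auto
    finally show ?thesis .
  qed
  have \<beta>0: "\<beta> \<ge> 0" using H D M1 by (simp add: \<beta>_def)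
  have bound: "norm (expsum \<alpha> T (real h * (of_int (c L) / of_int (lattice_det L))))
      \<le> f T L h + 2 * pi * \<beta> * (\<Sum>t<T. f t L h)" if L: "L \<in> \<Lambda>" and h: "h \<in> I" for L h
  proof -
    define q where "q = real_of_int (lattice_det L)"
    have q: "D \<le> q" "q > 0" using adm L D by (auto simp: admissible_family_def q_def)
    have mr: "real_of_int (m L) > 0" using m0[OF L] by simp
    have "real_of_int (c L * m L) = real_of_int (y L * lattice_det L + b L)" by (simp only: y(2)[OF L])
    then have cm: "of_int (c L) * of_int (m L) = of_int (y L) * q + of_int (b L)" by (simp add: q_def)
    have split: "real h * (of_int (c L) / q) = real h * of_int (y L) / of_int (m L) + real h * of_int (b L) / (q * of_int (m L))"
    proof -
      have "of_int (c L) / q = (of_int (c L) * of_int (m L)) / (q * of_int (m L))" using mr by simp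
      also have "\<dots> = of_int (y L) / of_int (m L) + of_int (b L) / (q * of_int (m L))"
        unfolding cm using mr q by (simp add: add_divide_distrib)
      finally show ?thesis by (simp add: distrib_left)
    qed
    have hb: "\<bar>real h * of_int (b L) / (q * of_int (m L))\<bar> \<le> \<beta>"
    proof -
      have "(m L)\<^sup>2 + (b L)\<^sup>2 \<le> 2 * lattice_det L"
        by (rule reduced_basis_norm_sq_le[OF red c pos]) (use L in auto)
      then have "(b L)\<^sup>2 \<le> 2 * lattice_det L" by (smt (verit) zero_le_power2)
      then have "real_of_int ((b L)\<^sup>2) \<le> real_of_int (2 * lattice_det L)" by (simp only: of_int_le_iff)
      then have "(real_of_int (b L))\<^sup>2 \<le> 4 * q" using q by (simp add: q_def)
      then have "\<bar>real_of_int (b L)\<bar> \<le> sqrt (4 * q)" by (metis real_sqrt_abs real_sqrt_le_mono)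
      then have b: "\<bar>real_of_int (b L)\<bar> \<le> 2 * sqrt q" by (simp add: real_sqrt_mult)
      have hH: "real h \<le> H" using h Hn by (auto simp: I_def)
      have "\<bar>real h * of_int (b L) / (q * of_int (m L))\<bar> = real h * \<bar>of_int (b L)\<bar> / (q * of_int (m L))"
        using mr q by (simp add: abs_mult)
      also have "\<dots> \<le> H * (2 * sqrt q) / (q * M1)"
        using hH b q mr m(1)[OF L] M1 H by (intro frac_le mult_mono mult_nonneg_nonneg mult_pos_pos) auto
      also have "\<dots> = 2 * H / (sqrt q * M1)"
      proof -
        have "q = sqrt q * sqrt q" using q by simp
        then have "H * (2 * sqrt q) / (q * M1) = H * (2 * sqrt q) / (sqrt q * sqrt q * M1)" by simp
        then show ?thesis using q M1 by (simp add: field_simps)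
      qed
      also have "\<dots> \<le> \<beta>"
        unfolding \<beta>_def using q D M1 H by (intro divide_left_mono mult_right_mono mult_pos_pos) auto
      finally show ?thesis .
    qed
    have "norm (expsum \<alpha> T (real h * (of_int (c L) / q)))
        \<le> f T L h + 2 * pi * \<bar>real h * of_int (b L) / (q * of_int (m L))\<bar> * (\<Sum>t<T. f t L h)"
      unfolding split f_def by (rule expsum_perturb)
    also have "\<dots> \<le> f T L h + 2 * pi * \<beta> * (\<Sum>t<T. f t L h)"
      using hb by (intro add_left_mono mult_right_mono mult_left_mono sum_nonneg) (auto simp: f_def)
    finally show ?thesis by (simp add: q_def)
  qed
  have "(\<Sum>L\<in>\<Lambda>. \<Sum>h\<in>I. norm (expsum \<alpha> T (real h * (of_int (c L) / of_int (lattice_det L)))))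
      \<le> (\<Sum>L\<in>\<Lambda>. \<Sum>h\<in>I. f T L h + 2 * pi * \<beta> * (\<Sum>t<T. f t L h))"
    by (intro sum_mono bound)
  also have "\<dots> = (\<Sum>L\<in>\<Lambda>. \<Sum>h\<in>I. f T L h) + 2 * pi * \<beta> * (\<Sum>L\<in>\<Lambda>. \<Sum>h\<in>I. \<Sum>t<T. f t L h)"
    by (simp only: sum.distrib sum_distrib_left)
  also have "(\<Sum>L\<in>\<Lambda>. \<Sum>h\<in>I. \<Sum>t<T. f t L h) = (\<Sum>t<T. \<Sum>L\<in>\<Lambda>. \<Sum>h\<in>I. f t L h)"
  proof -
    have "(\<Sum>h\<in>I. \<Sum>t<T. f t L h) = (\<Sum>t<T. \<Sum>h\<in>I. f t L h)" for L by (rule sum.swap)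
    then show ?thesis by (simp only:) (rule sum.swap)
  qed
  also have "(\<Sum>L\<in>\<Lambda>. \<Sum>h\<in>I. f T L h) + 2 * pi * \<beta> * (\<Sum>t<T. \<Sum>L\<in>\<Lambda>. \<Sum>h\<in>I. f t L h)
      \<le> Z + 2 * pi * \<beta> * (\<Sum>t<T. Z)"
    using \<beta>0 by (intro add_mono mult_left_mono sum_mono Y) auto
  also have "\<dots> = (1 + 2 * pi * \<beta> * real T) * Z" by (simp add: algebra_simps)
  finally show ?thesis by (simp only: I_def \<beta>_def Z_def)
qed

text \<open>A logarithm is absorbed into a power of \<open>N\<close>. The constant 33 fits
  \<open>n\<close> of size \<open>2 * M1\<^sup>2 + 1\<close> with \<open>M1 \<le> 4 * N\<close>, and
  the square is there because \<open>harm n\<close> is later used under a root.\<close>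

lemma harm_le_powr:
  assumes "\<epsilon> > 0" "N \<ge> 1" "n \<ge> 1" "real n \<le> 33 * N\<^sup>2"
  shows "harm n \<le> (34 + 1 / \<epsilon>) * (N powr \<epsilon>)\<^sup>2"
proof -
  have e1: "(N powr \<epsilon>)\<^sup>2 = N powr (2 * \<epsilon>)"
    using assms by (simp add: power2_eq_square flip: powr_add)
  have e2: "1 \<le> N powr (2 * \<epsilon>)" using assms by (intro ge_one_powr_ge_zero) auto
  have "harm n - ln (real n) \<le> harm 1 - ln (real 1)"
    using assms euler_mascheroni_sequence_decreasing[of 1 n] by simp
  then have "harm n \<le> 1 + ln (real n)" by (simp add: harm_def)
  also have "\<dots> \<le> 1 + ln (33 * N\<^sup>2)" using assms by (intro add_left_mono ln_mono) auto
  also have "\<dots> = 1 + ln 33 + 2 * ln N" using assms by (simp add: ln_mult ln_realpow)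
  also have "\<dots> \<le> 34 + 2 * (N powr (2 * \<epsilon>) / (2 * \<epsilon>))"
  proof -
    have "ln 33 \<le> (33::real)" using ln_le_minus_one[of "33::real"] by simp
    moreover have "ln N \<le> N powr (2 * \<epsilon>) / (2 * \<epsilon>)" using assms by (intro ln_powr_bound) auto
    ultimately show ?thesis by linarith
  qed
  also have "\<dots> \<le> (34 + 1 / \<epsilon>) * N powr (2 * \<epsilon>)"
    using e2 assms by (simp add: algebra_simps)
  finally show ?thesis by (simp add: e1)
qed

text \<open>The choice of \<open>H\<close> gives \<open>T * H \<le> D * d\<close>, and
  \<open>M1\<^sup>2 \<le> 4 * D\<close> absorbs the lower-order terms. The first factor costs 18,
  the root costs 12, and \<open>216 = 18 * 12\<close>.\<close>

lemma sieve_bound_simplify: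
  fixes N D M1 d H T K \<eta> :: real
  assumes N: "N \<ge> 1" and D: "D \<ge> 1" and M1: "M1 \<ge> 1" "M1\<^sup>2 \<le> 4 * D" and d: "d \<ge> 1"
    and H: "H = D * d / N" and T: "0 \<le> T" "T \<le> N" and K: "0 \<le> K" "K \<le> 2 * M1" and \<eta>: "1 \<le> \<eta>"
  shows "(1 + 2 * pi * (2 * H / (sqrt D * M1)) * T) * sqrt (T * (K * H * (2 * T * H + 16 * M1\<^sup>2 * \<eta>)))
    \<le> 216 * (sqrt D * D * d\<^sup>2 * sqrt \<eta> / sqrt M1)"
proof -
  have H0: "0 \<le> H" using H D d N by simp
  have "T * H \<le> N * H" using T H0 by (intro mult_right_mono)
  then have TH: "T * H \<le> D * d" using H N by simp
  have Dd: "0 \<le> D * d" "D \<le> D * d" using D d by (auto simp: mult_le_cancel_left1)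
  have sD: "sqrt D > 0" "sqrt D * sqrt D = D" using D by auto
  have sM: "sqrt M1 > 0" "sqrt M1 * sqrt M1 = M1" using M1 by auto
  have MD: "M1 \<le> 2 * sqrt D"
  proof -
    have "sqrt (M1\<^sup>2) \<le> sqrt (4 * D)" using M1 by (intro real_sqrt_le_mono)
    then show ?thesis using M1 by (simp add: real_sqrt_mult)
  qed
  have f1: "1 + 2 * pi * (2 * H / (sqrt D * M1)) * T \<le> 18 * (sqrt D * d / M1)"
  proof -
    have "M1 * 1 \<le> 2 * sqrt D * d" using MD d M1 D by (intro mult_mono) auto
    then have "1 \<le> 2 * (sqrt D * d / M1)" using M1 by (simp add: field_simps)
    moreover have "2 * pi * (2 * H / (sqrt D * M1)) * T \<le> 16 * (sqrt D * d / M1)"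
    proof -
      have "2 * pi * (2 * H / (sqrt D * M1)) * T = 4 * pi * (T * H / (sqrt D * M1))" by simp
      also have "\<dots> \<le> 16 * (D * d / (sqrt D * M1))"
      proof (rule mult_mono)
        show "T * H / (sqrt D * M1) \<le> D * d / (sqrt D * M1)"
          using TH M1 sD by (intro divide_right_mono) auto
      qed (use pi_less_4 T H0 M1 sD in auto)
      also have "D * d / (sqrt D * M1) = sqrt D * sqrt D * d / (sqrt D * M1)" by (simp only: sD(2))
      also have "\<dots> = sqrt D * d / M1" using sD(1) M1 by (simp add: field_simps)
      finally show ?thesis .
    qed
    ultimately show ?thesis by linarith
  qed
  have f2: "sqrt (T * (K * H * (2 * T * H + 16 * M1\<^sup>2 * \<eta>))) \<le> 12 * (D * d) * (sqrt M1 * sqrt \<eta>)"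
  proof (rule real_le_lsqrt)
    define u where "u = T * H"
    define v where "v = D * d"
    have u: "0 \<le> u" "u \<le> v" using TH T H0 by (auto simp: u_def v_def)
    have v: "M1\<^sup>2 \<le> 4 * v" using M1 Dd by (auto simp: v_def)
    have "2 * u + 16 * M1\<^sup>2 * \<eta> \<le> 66 * v * \<eta>"
    proof -
      have "2 * u * 1 \<le> 2 * v * \<eta>" using u \<eta> by (intro mult_mono) auto
      moreover have "16 * M1\<^sup>2 * \<eta> \<le> 16 * (4 * v) * \<eta>"
        using v \<eta> by (intro mult_right_mono) auto
      ultimately show ?thesis by (simp add: algebra_simps)
    qed
    then have "u * K * (2 * u + 16 * M1\<^sup>2 * \<eta>) \<le> v * (2 * M1) * (66 * v * \<eta>)"
      using u K \<eta> M1 by (intro mult_mono) auto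
    also have "\<dots> = 132 * (v\<^sup>2 * M1 * \<eta>)" by (simp add: power2_eq_square)
    also have "\<dots> \<le> 144 * (v\<^sup>2 * M1 * \<eta>)" using M1 \<eta> by (intro mult_right_mono) auto
    also have "\<dots> = (12 * v * (sqrt M1 * sqrt \<eta>))\<^sup>2" using M1 \<eta> by (simp add: power_mult_distrib)
    finally show "T * (K * H * (2 * T * H + 16 * M1\<^sup>2 * \<eta>)) \<le> (12 * (D * d) * (sqrt M1 * sqrt \<eta>))\<^sup>2"
      by (simp add: u_def v_def mult_ac)
    show "0 \<le> 12 * (D * d) * (sqrt M1 * sqrt \<eta>)" using Dd M1 \<eta> by simp
  qed
  have "(1 + 2 * pi * (2 * H / (sqrt D * M1)) * T) * sqrt (T * (K * H * (2 * T * H + 16 * M1\<^sup>2 * \<eta>)))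
      \<le> 18 * (sqrt D * d / M1) * (12 * (D * d) * (sqrt M1 * sqrt \<eta>))"
  proof (rule mult_mono[OF f1 f2])
    show "0 \<le> sqrt (T * (K * H * (2 * T * H + 16 * M1\<^sup>2 * \<eta>)))"
      using T K H0 \<eta> by (intro real_sqrt_ge_zero mult_nonneg_nonneg add_nonneg_nonneg) auto
  qed (use sD d M1 in auto)
  also have "\<dots> = 216 * (sqrt D * D * d\<^sup>2 * sqrt \<eta> * (sqrt M1 / M1))" by (simp add: power2_eq_square)
  also have "sqrt M1 / M1 = 1 / sqrt M1" using sM by (simp add: field_simps)
  finally show ?thesis by simp
qed

lemma nat_le_real_eq_atLeastAtMost:
  "N \<ge> 0 \<Longrightarrow> {m::nat. 1 \<le> m \<and> real m \<le> N} = {1..nat \<lfloor>N\<rfloor>}"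
  by (auto simp: le_nat_iff le_floor_iff)

section \<open>Summation of the errors over a family\<close>

context derivative_tower
begin

definition psi_error :: "real \<Rightarrow> (nat \<Rightarrow> complex) \<Rightarrow> (int \<times> int) set \<Rightarrow> real" where
  "psi_error N \<alpha> L = norm (psi (w 0) L N \<alpha> -
     complex_of_real (N * integral UNIV (w 0) / real_of_int (lattice_det L)) *
     (\<Sum>m\<in>{m::nat. 1 \<le> m \<and> real m \<le> N}. \<alpha> m))"

text \<open>At most \<open>8 * N\<close> lattices occur, each with error at most \<open>N\<close>
  times a power saving in \<open>N / q \<ge> d / 2\<close>, where
  \<open>d = N powr \<delta>\<close>. Taking \<open>k\<close> large makes \<open>d ^ k\<close>
  exceed \<open>N powr (A + 2)\<close>.\<close>

lemma sum_psi_error_small_det: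
  assumes N: "1 \<le> N" and D: "1 \<le> D" and M1: "1 \<le> M1" and \<alpha>: "\<And>m. norm (\<alpha> m) \<le> 1"
    and adm: "admissible_family D M1 \<Lambda> B1 B2" and DN: "D \<le> N powr (1 - \<delta>)" and \<delta>: "0 < \<delta>"
    and k: "A + 2 \<le> \<delta> * real k" and C: "\<And>t. \<bar>w (Suc k) t\<bar> \<le> C"
  shows "(\<Sum>L\<in>\<Lambda>. psi_error N \<alpha> L) \<le> 88 * C * 2 ^ k * N powr (- A)"
proof (cases "\<Lambda> = {}")
  case True
  then show ?thesis using C[of 0] by simp
next
  case False
  define d where "d = N powr \<delta>"
  have d: "1 \<le> d" unfolding d_def using N \<delta> by (intro ge_one_powr_ge_zero) auto
  have DN': "D \<le> N / d" using DN N by (simp add: d_def powr_diff)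
  have C0: "C \<ge> 0" using C[of 0] by linarith
  obtain c where c: "\<forall>L\<in>\<Lambda>. lattice_det L > 0 \<and> (\<forall>m n. (m, n) \<in> L \<longleftrightarrow> lattice_det L dvd n - c L * m)"
    using admissible_family_residue_forms[OF adm] by blast
  have range: "{m::nat. 1 \<le> m \<and> real m \<le> N} = {1..nat \<lfloor>N\<rfloor>}"
    using N by (intro nat_le_real_eq_atLeastAtMost) simp
  have err: "psi_error N \<alpha> L \<le> N * (11 * C / (d / 2) ^ k)" if L: "L \<in> \<Lambda>" for L
  proof -
    define q where "q = nat (lattice_det L)"
    have det: "lattice_det L > 0" using c L by blast
    have q: "q > 0" "int q = lattice_det L" "real q = of_int (lattice_det L)"
      using det by (auto simp: q_def)
    have "real q \<le> 2 * D" using adm L q by (auto simp: admissible_family_def intro: less_imp_le)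
    then have "real q \<le> 2 * (N / d)" using DN' by linarith
    then have X: "d / 2 \<le> N / real q" using q(1) d by (simp add: field_simps)
    have "psi_error N \<alpha> L \<le> N * (11 * C / (N / real q) ^ k)"
      unfolding psi_error_def q(3)[symmetric] range
    proof (rule psi_error_le_of_small_det[OF q(1) _ _ \<alpha> C])
      show "1 / 2 \<le> N / real q" using X d by linarith
      show "(m, n) \<in> L \<longleftrightarrow> int q dvd n - c L * m" for m n using c L q(2) by simp
    qed
    also have "\<dots> \<le> N * (11 * C / (d / 2) ^ k)"
    proof -
      have "(d / 2) ^ k \<le> (N / real q) ^ k" using X d by (intro power_mono) auto
      then show ?thesis using N C0 d q by (intro mult_left_mono divide_left_mono mult_pos_pos zero_less_power divide_pos_pos) auto
    qed
    finally show ?thesis .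
  qed
  obtain L where "L \<in> \<Lambda>" using False by blast
  then have "M1\<^sup>2 \<le> 4 * D" by (rule admissible_family_M1_sq_le[OF adm M1])
  moreover have "M1 \<le> M1\<^sup>2" using M1 by (simp add: power2_eq_square)
  moreover have "N / d \<le> N / 1" using N d by (intro divide_left_mono) auto
  ultimately have "M1 \<le> 4 * N" using DN' by simp
  then have card: "real (card \<Lambda>) \<le> 8 * N" using admissible_family_card[OF adm M1] by linarith
  have dk: "N powr A * N\<^sup>2 \<le> d ^ k"
  proof -
    have "N powr A * N\<^sup>2 = N powr (A + 2)" using N by (simp add: powr_add powr_numeral)
    also have "\<dots> \<le> N powr (\<delta> * real k)" using N k by (intro powr_mono) auto
    also have "\<dots> = d ^ k" using N by (simp add: d_def powr_powr[symmetric] powr_realpow)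
    finally show ?thesis .
  qed
  have "(\<Sum>L\<in>\<Lambda>. psi_error N \<alpha> L) \<le> real (card \<Lambda>) * (N * (11 * C / (d / 2) ^ k))"
    by (rule sum_bounded_above[OF err])
  also have "\<dots> \<le> (8 * N) * (N * (11 * C / (d / 2) ^ k))"
    using card N C0 d by (intro mult_right_mono) auto
  also have "\<dots> = 88 * C * 2 ^ k * (N\<^sup>2 / d ^ k)" by (simp add: power2_eq_square power_divide)
  also have "\<dots> \<le> 88 * C * 2 ^ k * (N\<^sup>2 / (N powr A * N\<^sup>2))"
    using dk C0 N d by (intro mult_left_mono divide_left_mono) auto
  also have "\<dots> = 88 * C * 2 ^ k * N powr (- A)" using N by (simp add: powr_minus_divide)
  finally show ?thesis .
qed

text \<open>The hypothesis on \<open>D\<close> says exactly that the cutoff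
  \<open>H = D * d / N\<close> is below \<open>M1\<close>, as the sieve needs. The choice of
  \<open>k\<close> makes the discarded frequencies contribute a bounded amount in total.\<close>

lemma sum_psi_error_large_det:
  assumes N: "1 \<le> N" and D: "1 \<le> D" and M1: "1 \<le> M1" and \<alpha>: "\<And>m. norm (\<alpha> m) \<le> 1"
    and adm: "admissible_family D M1 \<Lambda> B1 B2" and DM: "D < M1 * N powr (1 - \<delta>)"
    and \<delta>: "0 < \<delta>" and \<epsilon>: "0 < \<epsilon>" and k: "3 \<le> \<delta> * real k"
    and C0: "\<And>t. \<bar>w 0 t\<bar> \<le> C0" and C1: "\<And>t. \<bar>w 1 t\<bar> \<le> C1" and Ck: "\<And>t. \<bar>w k t\<bar> \<le> Ck"
  shows "(\<Sum>L\<in>\<Lambda>. psi_error N \<alpha> L) \<le> (176 * C1 + 4752 * C0 * sqrt (34 + 1 / \<epsilon>) + 176 * Ck)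
    * N powr (1 + 2 * \<delta> + \<epsilon>) * M1 powr (- 1 / 2) * D powr (1 / 2)"
proof -
  define d where "d = N powr \<delta>"
  define e where "e = N powr \<epsilon>"
  define H where "H = D * d / N"
  define P where "P = N * d\<^sup>2 * e * sqrt D / sqrt M1"
  define T where "T = nat \<lfloor>N\<rfloor>"
  define n where "n = nat \<lceil>2 * M1\<^sup>2\<rceil>"
  have d: "1 \<le> d" unfolding d_def using N \<delta> by (intro ge_one_powr_ge_zero) auto
  have e: "1 \<le> e" unfolding e_def using N \<epsilon> by (intro ge_one_powr_ge_zero) auto
  have pos: "C0 \<ge> 0" "C1 \<ge> 0" "Ck \<ge> 0" using C0[of 0] C1[of 0] Ck[of 0] by linarith+
  have TN: "real T \<le> N" using N by (simp add: T_def)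
  have powP: "N powr (1 + 2 * \<delta> + \<epsilon>) * M1 powr (- 1 / 2) * D powr (1 / 2) = P"
  proof -
    have "N powr (2 * \<delta>) = d\<^sup>2" using N by (simp add: d_def power2_eq_square flip: powr_add)
    then have "N powr (1 + 2 * \<delta> + \<epsilon>) = N * d\<^sup>2 * e" using N by (simp add: powr_add e_def)
    moreover have "M1 powr (- 1 / 2) = 1 / sqrt M1" using M1 by (simp add: powr_minus_divide powr_half_sqrt flip: minus_divide_left)
    moreover have "D powr (1 / 2) = sqrt D" using D by (simp add: powr_half_sqrt)
    ultimately show ?thesis by (simp add: P_def)
  qed
  show ?thesis
  proof (cases "\<Lambda> = {}")
    case True
    have "0 \<le> P" using N d e D M1 by (simp add: P_def)
    then show ?thesis using True pos \<epsilon> by (simp add: powP mult.assoc)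
  next
    case False
    then obtain L0 where "L0 \<in> \<Lambda>" by blast
    then have MD: "M1\<^sup>2 \<le> 4 * D" by (rule admissible_family_M1_sq_le[OF adm M1])
    have MM: "M1 \<le> M1\<^sup>2" using M1 by (simp add: power2_eq_square)
    have DM': "D < M1 * (N / d)" using DM N by (simp add: d_def powr_diff)
    have HM: "H < M1" using DM' N d by (simp add: H_def field_simps)
    have H0: "0 \<le> H" using D d N by (simp add: H_def)
    have MN: "M1 \<le> 4 * N"
    proof -
      have "N / d \<le> N / 1" using N d by (intro divide_left_mono) auto
      then have "M1 * (N / d) \<le> M1 * N" using M1 by (intro mult_left_mono) auto
      then have "M1 * M1 \<le> M1 * (4 * N)" using MD DM' unfolding power2_eq_square by linarith
      then show ?thesis using M1 by simp
    qed
    \<comment> \<open>\<open>P\<close> is the target bound, so errors of size \<open>N\<close> or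
      smaller are admissible; this absorbs frequency 0 and the tail.\<close>
    have NP: "N \<le> 2 * P"
    proof -
      have "sqrt M1 \<le> sqrt (4 * D)" using MM MD by (intro real_sqrt_le_mono) linarith
      then have "sqrt M1 \<le> 2 * sqrt D" by (simp add: real_sqrt_mult)
      then have "1 \<le> 2 * (sqrt D / sqrt M1)" using M1 by (simp add: field_simps)
      moreover have "N * 1 * 1 \<le> N * d\<^sup>2 * e" using N d e by (intro mult_mono one_le_power) auto
      ultimately have "(N * 1 * 1) * 1 \<le> (N * d\<^sup>2 * e) * (2 * (sqrt D / sqrt M1))"
        using N d e by (intro mult_mono) auto
      also have "\<dots> = 2 * P" unfolding P_def by (simp only: times_divide_eq_right mult_ac)
      finally show ?thesis by simp
    qed
    have card: "real (card \<Lambda>) \<le> 2 * M1" by (rule admissible_family_card[OF adm M1])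
    have n: "2 * M1\<^sup>2 \<le> real n" unfolding n_def by (rule real_nat_ceiling_ge)
    have harm1: "1 \<le> (harm n :: real)" and harm2: "harm n \<le> (34 + 1 / \<epsilon>) * e\<^sup>2"
    proof -
      have n1: "1 \<le> n" using n M1 MM by linarith
      then have "harm 1 \<le> (harm n :: real)" by (rule harm_mono)
      then show "1 \<le> (harm n :: real)" by (simp add: harm_def)
      have "M1\<^sup>2 \<le> (4 * N)\<^sup>2" using MN M1 by (intro power_mono) auto
      moreover have "real n \<le> 2 * M1\<^sup>2 + 1" unfolding n_def using M1 by simp
      moreover have "1 \<le> N\<^sup>2" using N by (intro one_le_power)
      ultimately have "real n \<le> 33 * N\<^sup>2" by (simp add: power_mult_distrib)
      then show "harm n \<le> (34 + 1 / \<epsilon>) * e\<^sup>2" unfolding e_def by (rule harm_le_powr[OF \<epsilon> N n1])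
    qed
    have sharm: "sqrt (harm n) \<le> sqrt (34 + 1 / \<epsilon>) * e"
    proof -
      have "sqrt (harm n) \<le> sqrt ((34 + 1 / \<epsilon>) * e\<^sup>2)" by (rule real_sqrt_le_mono[OF harm2])
      then show ?thesis using e by (simp add: real_sqrt_mult)
    qed
    obtain c where c: "\<forall>L\<in>\<Lambda>. lattice_det L > 0 \<and> (\<forall>m n. (m, n) \<in> L \<longleftrightarrow> lattice_det L dvd n - c L * m)"
      using admissible_family_residue_forms[OF adm] by blast
    define \<theta> where "\<theta> L = of_int (c L) / real_of_int (lattice_det L)" for L
    define Y where "Y \<gamma> = (\<Sum>L\<in>\<Lambda>. \<Sum>h\<in>{1..nat \<lfloor>H\<rfloor>}. norm (expsum \<gamma> T (real h * \<theta> L)))" for \<gamma>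
    define Z where "Z = 216 * (sqrt D * D * d\<^sup>2 * (sqrt (34 + 1 / \<epsilon>) * e) / sqrt M1)"
    have Y: "Y \<gamma> \<le> Z" if \<gamma>: "\<And>m. norm (\<gamma> m) \<le> 1" for \<gamma>
    proof -
      have "Y \<gamma> \<le> (1 + 2 * pi * (2 * H / (sqrt D * M1)) * real T)
          * sqrt (real T * (real (card \<Lambda>) * H * (2 * real T * H + 16 * M1\<^sup>2 * harm n)))"
        unfolding Y_def \<theta>_def
        by (rule admissible_family_sum_expsum_le[OF adm D M1 _ _ H0 HM n \<gamma>]) (use c in blast)+
      also have "\<dots> \<le> 216 * (sqrt D * D * d\<^sup>2 * sqrt (harm n) / sqrt M1)"
        by (rule sieve_bound_simplify[OF N D M1 MD d H_def _ TN _ card harm1]) auto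
      also have "\<dots> \<le> Z"
        unfolding Z_def using sharm D d M1
        by (intro mult_left_mono divide_right_mono) auto
      finally show ?thesis .
    qed
    have range: "{m::nat. 1 \<le> m \<and> real m \<le> N} = {1..nat \<lfloor>N\<rfloor>}"
      using N by (intro nat_le_real_eq_atLeastAtMost) simp
    have err: "psi_error N \<alpha> L \<le> 44 * C1 * N / M1 + 11 * N * C0 / D *
        ((\<Sum>h\<in>{1..nat \<lfloor>H\<rfloor>}. norm (expsum \<alpha> T (real h * \<theta> L)))
         + (\<Sum>h\<in>{1..nat \<lfloor>H\<rfloor>}. norm (expsum (\<lambda>m. cnj (\<alpha> m)) T (real h * \<theta> L))))
        + 11 * N\<^sup>2 * Ck / N ^ 3" (is "_ \<le> _ + _ * ?S + _") if L: "L \<in> \<Lambda>" for L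
    proof -
      define q where "q = nat (lattice_det L)"
      have det: "lattice_det L > 0" using c L by blast
      have q: "q > 0" "int q = lattice_det L" "real q = of_int (lattice_det L)"
        using det by (auto simp: q_def)
      have qD: "D \<le> real q" "real q \<le> 2 * D"
        using adm L q by (auto simp: admissible_family_def intro: less_imp_le)
      \<comment> \<open>The cutoff is chosen so that \<open>q \<le> 2 * D\<close> yields a gain of
        \<open>d\<close> per round of decay.\<close>
      have \<rho>: "d \<le> 2 * N * H / real q"
      proof -
        have "d * real q \<le> d * (2 * D)" using qD d by (intro mult_left_mono) auto
        also have "\<dots> = 2 * N * H" using N by (simp add: H_def)
        finally show ?thesis using q(1) by (simp add: pos_le_divide_eq)
      qed
      have "psi_error N \<alpha> L \<le> (11 * C1 * N + 11 * N * C0 * ?S) / real q + 11 * N\<^sup>2 * Ck / d ^ k"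
        unfolding psi_error_def \<theta>_def q(3)[symmetric] range T_def expsum_uminus[symmetric]
      proof (rule psi_error_le_expsums[OF N q(1) _ \<alpha> _ \<rho> C0 C1 Ck])
        show "(m, n) \<in> L \<longleftrightarrow> int q dvd n - c L * m" for m n using c L q(2) by simp
      qed (use d in simp)
      also have "\<dots> \<le> (11 * C1 * N + 11 * N * C0 * ?S) / D + 11 * N\<^sup>2 * Ck / N ^ 3"
      proof (intro add_mono divide_left_mono)
        have "N ^ 3 = N powr 3" using N by (simp add: powr_numeral)
        also have "\<dots> \<le> N powr (\<delta> * real k)" using N k by (intro powr_mono) auto
        also have "\<dots> = d ^ k" using N by (simp add: d_def powr_powr[symmetric] powr_realpow)
        finally show "N ^ 3 \<le> d ^ k" .
        show "0 \<le> 11 * C1 * N + 11 * N * C0 * ?S"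
          using pos N by (intro add_nonneg_nonneg mult_nonneg_nonneg sum_nonneg) auto
      qed (use qD D N d pos q in auto)
      also have "(11 * C1 * N + 11 * N * C0 * ?S) / D = 11 * C1 * N * (1 / D) + 11 * N * C0 / D * ?S"
        by (simp add: add_divide_distrib)
      also have "11 * C1 * N * (1 / D) \<le> 11 * C1 * N * (4 / M1)"
      \<comment> \<open>With \<open>1 / M1\<close> in place of \<open>1 / D\<close>, summing over at
        most \<open>2 * M1\<close> lattices leaves a multiple of \<open>N\<close>.\<close>
      proof (rule mult_left_mono)
        show "1 / D \<le> 4 / M1" using MM MD M1 D by (simp add: field_simps)
      qed (use pos N in auto)
      finally show ?thesis by simp
    qed
    have "(\<Sum>L\<in>\<Lambda>. psi_error N \<alpha> L) \<le> (\<Sum>L\<in>\<Lambda>. 44 * C1 * N / M1 + 11 * N * C0 / D *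
        ((\<Sum>h\<in>{1..nat \<lfloor>H\<rfloor>}. norm (expsum \<alpha> T (real h * \<theta> L)))
         + (\<Sum>h\<in>{1..nat \<lfloor>H\<rfloor>}. norm (expsum (\<lambda>m. cnj (\<alpha> m)) T (real h * \<theta> L))))
        + 11 * N\<^sup>2 * Ck / N ^ 3)"
      by (intro sum_mono err)
    also have "\<dots> = real (card \<Lambda>) * (44 * C1 * N / M1) + 11 * N * C0 / D * (Y \<alpha> + Y (\<lambda>m. cnj (\<alpha> m)))
        + real (card \<Lambda>) * (11 * N\<^sup>2 * Ck / N ^ 3)"
      by (simp only: sum.distrib sum_distrib_left[symmetric] Y_def sum_constant)
    also have "\<dots> \<le> 2 * M1 * (44 * C1 * N / M1) + 11 * N * C0 / D * (Z + Z) + 2 * (4 * N) * (11 * N\<^sup>2 * Ck / N ^ 3)"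
      using card MN pos N D M1 \<alpha> by (intro add_mono mult_right_mono mult_left_mono Y) auto
    also have "\<dots> = 88 * C1 * N + 22 * N * C0 * (Z / D) + 88 * Ck"
      using M1 N by (simp add: power2_eq_square power3_eq_cube)
    also have "Z / D = 216 * (sqrt D * d\<^sup>2 * (sqrt (34 + 1 / \<epsilon>) * e) / sqrt M1)"
      using D by (simp add: Z_def)
    also have "88 * C1 * N + 22 * N * C0 * (216 * (sqrt D * d\<^sup>2 * (sqrt (34 + 1 / \<epsilon>) * e) / sqrt M1)) + 88 * Ck
        = 88 * C1 * N + 4752 * C0 * sqrt (34 + 1 / \<epsilon>) * P + 88 * Ck * 1"
      by (simp add: P_def)
    also have "\<dots> \<le> 88 * C1 * (2 * P) + 4752 * C0 * sqrt (34 + 1 / \<epsilon>) * P + 88 * Ck * (2 * P)"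
      using NP N pos by (intro add_mono mult_left_mono order_refl) auto
    also have "\<dots> = (176 * C1 + 4752 * C0 * sqrt (34 + 1 / \<epsilon>) + 176 * Ck) * P" by (simp add: algebra_simps)
    finally show ?thesis by (simp only: powP[symmetric] mult.assoc)
  qed
qed

end

theorem theorem2:
  fixes W :: "real \<Rightarrow> real" and \<delta> :: real
  assumes "smooth W"
    and "\<And>t. 0 \<le> W t"
    and "closure {t. W t \<noteq> 0} \<subseteq> {0..1}"
    and "0 < \<delta>"
  shows "(\<forall>A>0. \<exists>C::real. \<forall>(N::real) D M1 (\<alpha>::nat \<Rightarrow> complex) \<Lambda> B1 B2.
      1 \<le> N \<and> 1 \<le> D \<and> 1 \<le> M1 \<and> (\<forall>m. norm (\<alpha> m) \<le> 1) \<and>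
      admissible_family D M1 \<Lambda> B1 B2 \<and> D \<le> N powr (1 - \<delta>) \<longrightarrow>
      (\<Sum>L\<in>\<Lambda>. norm (psi W L N \<alpha> -
          complex_of_real (N * integral UNIV W / real_of_int (lattice_det L)) *
          (\<Sum>m\<in>{m::nat. 1 \<le> m \<and> real m \<le> N}. \<alpha> m)))
        \<le> C * N powr (- A))
    \<and> (\<forall>\<epsilon>>0. \<exists>C::real. \<forall>(N::real) D M1 (\<alpha>::nat \<Rightarrow> complex) \<Lambda> B1 B2.
      1 \<le> N \<and> 1 \<le> D \<and> 1 \<le> M1 \<and> (\<forall>m. norm (\<alpha> m) \<le> 1) \<and>
      admissible_family D M1 \<Lambda> B1 B2 \<and>
      N powr (1 - \<delta>) \<le> D \<and> D < M1 * N powr (1 - \<delta>) \<longrightarrow>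
      (\<Sum>L\<in>\<Lambda>. norm (psi W L N \<alpha> -
          complex_of_real (N * integral UNIV W / real_of_int (lattice_det L)) *
          (\<Sum>m\<in>{m::nat. 1 \<le> m \<and> real m \<le> N}. \<alpha> m)))
        \<le> C * N powr (1 + 2 * \<delta> + \<epsilon>) * M1 powr (- 1 / 2) * D powr (1 / 2))"
proof -
  interpret derivative_tower "\<lambda>k. (deriv ^^ k) W"
    by unfold_locales
      (use assms in \<open>auto intro: smooth_has_higher_deriv higher_deriv_eq_0_outside_support simp del: funpow.simps\<close>)
  have error: "psi_error N \<alpha> L = norm (psi W L N \<alpha> -
      complex_of_real (N * integral UNIV W / real_of_int (lattice_det L)) *
      (\<Sum>m\<in>{m::nat. 1 \<le> m \<and> real m \<le> N}. \<alpha> m))" for N \<alpha> L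
    unfolding psi_error_def funpow_0 ..
  \<comment> \<open>The number of derivatives depends only on \<open>\<delta>\<close> and the
    desired saving, so the constants are fixed before \<open>N\<close>, \<open>D\<close>,
    \<open>M1\<close> and the family.\<close>
  have large_exponent: "\<exists>k. x \<le> \<delta> * real k" for x
  proof -
    obtain k where "x / \<delta> \<le> real k" using real_arch_simple by blast
    then show ?thesis using assms(4) by (auto simp: field_simps)
  qed
  show ?thesis
    unfolding error[symmetric]
  proof (intro conjI allI impI)
    fix A :: real
    obtain k where k: "A + 2 \<le> \<delta> * real k" using large_exponent by blast
    obtain C where C: "\<And>t. \<bar>(deriv ^^ Suc k) W t\<bar> \<le> C" using bounded by metis
    show "\<exists>C. \<forall>N D M1 \<alpha> \<Lambda> B1 B2.
        1 \<le> N \<and> 1 \<le> D \<and> 1 \<le> M1 \<and> (\<forall>m. norm (\<alpha> m) \<le> 1) \<and>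
        admissible_family D M1 \<Lambda> B1 B2 \<and> D \<le> N powr (1 - \<delta>) \<longrightarrow>
        (\<Sum>L\<in>\<Lambda>. psi_error N \<alpha> L) \<le> C * N powr (- A)"
      by (intro exI allI impI, elim conjE, rule sum_psi_error_small_det[OF _ _ _ _ _ _ assms(4) k C]) auto
  next
    fix \<epsilon> :: real assume \<epsilon>: "0 < \<epsilon>"
    \<comment> \<open>A saving of \<open>N ^ 3\<close> cancels the factor \<open>N\<^sup>2\<close>
      of each tail and the \<open>O(N)\<close> lattices.\<close>
    obtain k where k: "3 \<le> \<delta> * real k" using large_exponent by blast
    obtain C0 C1 Ck where C: "\<And>t. \<bar>(deriv ^^ 0) W t\<bar> \<le> C0" "\<And>t. \<bar>(deriv ^^ 1) W t\<bar> \<le> C1"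
        "\<And>t. \<bar>(deriv ^^ k) W t\<bar> \<le> Ck"
      using bounded by metis
    show "\<exists>C. \<forall>N D M1 \<alpha> \<Lambda> B1 B2.
        1 \<le> N \<and> 1 \<le> D \<and> 1 \<le> M1 \<and> (\<forall>m. norm (\<alpha> m) \<le> 1) \<and>
        admissible_family D M1 \<Lambda> B1 B2 \<and>
        N powr (1 - \<delta>) \<le> D \<and> D < M1 * N powr (1 - \<delta>) \<longrightarrow>
        (\<Sum>L\<in>\<Lambda>. psi_error N \<alpha> L)
          \<le> C * N powr (1 + 2 * \<delta> + \<epsilon>) * M1 powr (- 1 / 2) * D powr (1 / 2)"
      by (intro exI allI impI, elim conjE, rule sum_psi_error_large_det[OF _ _ _ _ _ _ assms(4) \<epsilon> k C]) auto
  qed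
qed

end
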